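(* Let $X,\sigma,\omega,f,V_f$ be as in the context, let $\mathcal{M}\subset\mathcal{O}(V_f)$ be a free $\mathbb{Z}$-module of rank $N$ with basis $\mathfrak{f}_1,\dots,\mathfrak{f}_N$, and let $Q^\sigma_N=\left(\int_\sigma\mathfrak{f}_i\mathfrak{f}_j\,\omega\right)_{1\le i,j\le N}$. If $N=\mathrm{rank}\,\mathcal{M}$ is larger than a constant which depends only on $\int_\sigma\omega$, then $$\left|\det Q^\sigma_N\right|^{1/N}<t_{\mathcal{M}}(\sigma)^{2/N}.$$ If, furthermore, the following assumptions hold: (P1) the form $\omega$ is real and non-negative on $\sigma$; (P2) the generators $\mathfrak{f}_1,\dots,\mathfrak{f}_N$ of $\mathcal{M}$ are real-valued on $\sigma$; (P3) the domain $\sigma$ is Zariski-dense in $X$; then $0<\left(\det Q^\sigma_N\right)^{1/N}$.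
   Context: $X$ is an affine algebraic variety over $\mathbb{Q}$ with a morphism $f=(f_1,\dots,f_r):X\to\mathbb{A}^r$ over $\mathbb{Q}$; $\omega\in\Omega^d(X)$ is a regular differential form of degree $d$; $\sigma\subset X(\mathbb{C})$ is a relative $d$-chain whose boundary is contained in the complex points of a divisor $Y\subset X$. $V_f\subset\mathbb{A}^r$ is the Zariski closure of $f(X)$; $\mathcal{O}(V_f)$ embeds in $\mathcal{O}(X)$ via $f^*$ and its elements are regarded as functions on $X$ and on $\sigma$. Define $$t_{\mathcal{M}}(\sigma)=\sup_{(z_1,\dots,z_N)\in\sigma^N}\left|\det(\mathfrak{f}_j(z_i))_{1\le i,j\le N}\right|,$$ which is independent of the choice of basis of $\mathcal{M}$.
   Formalization: The constant depends on the total mass ∫_σ|ω| (equal to ∫_σ ω when ω ≥ 0) instead of ∫_σ ω; the inequality is strict only if t_M(σ) ≠ 0 (otherwise ≤); positivity also assumes that the points of σ where ω does not vanish are Zariski-dense in σ. *)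

theory Defs
  imports "HOL-Analysis.Analysis" "HOL-Homology.Homology" "HOL-Library.Poly_Mapping"
    "Jordan_Normal_Form.Matrix" "Jordan_Normal_Form.Determinant"
begin

text \<open>
  Complex points of affine \<open>n\<close>-space are the extensional functions
  \<open>{..<n} \<rightarrow>\<^sub>E UNIV :: (nat \<Rightarrow> complex) set\<close>. Dimensions are numbers, not types, because the
  main statement quantifies over them after the choice of a constant.
\<close>

abbreviation affine_space :: "nat \<Rightarrow> (nat \<Rightarrow> complex) set" where
  "affine_space n \<equiv> {..<n} \<rightarrow>\<^sub>E UNIV"

section \<open>Polynomials and affine varieties\<close>

type_synonym cpoly = "(nat \<Rightarrow>\<^sub>0 nat) \<Rightarrow>\<^sub>0 complex"

definition peval :: "cpoly \<Rightarrow> (nat \<Rightarrow> complex) \<Rightarrow> complex" where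
  "peval p x = (\<Sum>m\<in>Poly_Mapping.keys p. Poly_Mapping.lookup p m *
      (\<Prod>i\<in>Poly_Mapping.keys m. x i ^ Poly_Mapping.lookup m i))"

text \<open>\<open>K[x_0, \<dots>, x_(n-1)]\<close> for a set \<open>K\<close> of complex numbers; only \<open>K = \<rat>\<close> and
  \<open>K = UNIV\<close> are used.\<close>

definition polys_over :: "complex set \<Rightarrow> nat \<Rightarrow> cpoly set" where
  "polys_over K n = {p. \<forall>m\<in>Poly_Mapping.keys p.
      Poly_Mapping.keys m \<subseteq> {..<n} \<and> Poly_Mapping.lookup p m \<in> K}"

text \<open>A (reduced, possibly reducible) affine variety over the rationals, given by its set of
  complex points.\<close>

definition affine_variety :: "nat \<Rightarrow> (nat \<Rightarrow> complex) set \<Rightarrow> bool" where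
  "affine_variety n X \<longleftrightarrow> (\<exists>S. finite S \<and> S \<subseteq> polys_over \<rat> n \<and>
      X = {x \<in> affine_space n. \<forall>p\<in>S. peval p x = 0})"

definition zariski_closure ::
    "complex set \<Rightarrow> nat \<Rightarrow> (nat \<Rightarrow> complex) set \<Rightarrow> (nat \<Rightarrow> complex) set" where
  "zariski_closure K n A =
     {x \<in> affine_space n. \<forall>p\<in>polys_over K n. (\<forall>a\<in>A. peval p a = 0) \<longrightarrow> peval p x = 0}"

text \<open>The ring \<open>\<O>(X)\<close> of regular functions over the rationals. As \<open>X\<close> is reduced, a regular
  function is determined by its values on the complex points of \<open>X\<close>.\<close>

definition coord_ring :: "nat \<Rightarrow> (nat \<Rightarrow> complex) set \<Rightarrow> ((nat \<Rightarrow> complex) \<Rightarrow> complex) set" where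
  "coord_ring n X = (\<lambda>p. restrict (peval p) X) ` polys_over \<rat> n"

definition morphism_map ::
    "nat \<Rightarrow> (nat \<Rightarrow> (nat \<Rightarrow> complex) \<Rightarrow> complex) \<Rightarrow> (nat \<Rightarrow> complex) \<Rightarrow> (nat \<Rightarrow> complex)" where
  "morphism_map r f x = (\<lambda>k\<in>{..<r}. f k x)"

definition irreducible_variety :: "nat \<Rightarrow> (nat \<Rightarrow> complex) set \<Rightarrow> bool" where
  "irreducible_variety n W \<longleftrightarrow> affine_variety n W \<and> W \<noteq> {} \<and>
     (\<forall>A B. affine_variety n A \<longrightarrow> affine_variety n B \<longrightarrow> W \<subseteq> A \<union> B \<longrightarrow> W \<subseteq> A \<or> W \<subseteq> B)"

definition irreducible_component ::
    "nat \<Rightarrow> (nat \<Rightarrow> complex) set \<Rightarrow> (nat \<Rightarrow> complex) set \<Rightarrow> bool" where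
  "irreducible_component n Y W \<longleftrightarrow> irreducible_variety n W \<and> W \<subseteq> Y \<and>
     (\<forall>Z. irreducible_variety n Z \<longrightarrow> W \<subseteq> Z \<longrightarrow> Z \<subseteq> Y \<longrightarrow> Z = W)"

text \<open>The longest chains of irreducible closed subsets of \<open>X\<close> that start at \<open>W\<close> have
  length one.\<close>

definition codim_one :: "nat \<Rightarrow> (nat \<Rightarrow> complex) set \<Rightarrow> (nat \<Rightarrow> complex) set \<Rightarrow> bool" where
  "codim_one n X W \<longleftrightarrow>
     (\<exists>Z. irreducible_variety n Z \<and> W \<subset> Z \<and> Z \<subseteq> X) \<and>
     \<not> (\<exists>Z Z'. irreducible_variety n Z \<and> irreducible_variety n Z' \<and> W \<subset> Z \<and> Z \<subset> Z' \<and> Z' \<subseteq> X)"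

definition divisor_of :: "nat \<Rightarrow> (nat \<Rightarrow> complex) set \<Rightarrow> (nat \<Rightarrow> complex) set \<Rightarrow> bool" where
  "divisor_of n X Y \<longleftrightarrow> affine_variety n Y \<and> Y \<subseteq> X \<and>
     (\<forall>W. irreducible_component n Y W \<longrightarrow> codim_one n X W)"

section \<open>Finitely generated free modules of regular functions\<close>

definition is_int_basis :: "((nat \<Rightarrow> complex) \<Rightarrow> complex) set \<Rightarrow> (nat \<Rightarrow> complex) set \<Rightarrow> nat
    \<Rightarrow> (nat \<Rightarrow> (nat \<Rightarrow> complex) \<Rightarrow> complex) \<Rightarrow> bool" where
  "is_int_basis M V N b \<longleftrightarrow>
     M = range (\<lambda>c :: nat \<Rightarrow> int. \<lambda>y\<in>V. \<Sum>i<N. of_int (c i) * b i y) \<and>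
     (\<forall>i<N. b i \<in> M) \<and>
     (\<forall>c :: nat \<Rightarrow> int. (\<forall>y\<in>V. (\<Sum>i<N. of_int (c i) * b i y) = 0) \<longrightarrow> (\<forall>i<N. c i = 0))"

section \<open>Differential forms, chains and integration\<close>

text \<open>
  \<open>\<Omega>\<^sup>d(X)\<close> is generated over \<open>\<O>(X)\<close> by the \<open>dx_I\<close>, where \<open>I\<close> runs through the
  \<open>d\<close>-element subsets of \<open>{..<n}\<close>. A form \<open>\<Sum>\<^sub>I w_I dx_I\<close> is given by its family of
  coefficients \<open>w\<close>. The relations between the \<open>dx_I\<close> are generated by the differentials of
  functions vanishing on \<open>X\<close>; they pull back to zero along simplices in \<open>X\<close>, so that everything
  below depends only on the class of the form.
\<close>

type_synonym diff_form = "nat set \<Rightarrow> (nat \<Rightarrow> complex) \<Rightarrow> complex"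

definition index_sets :: "nat \<Rightarrow> nat \<Rightarrow> nat set set" where
  "index_sets n d = {I. I \<subseteq> {..<n} \<and> card I = d}"

definition diff_forms :: "nat \<Rightarrow> (nat \<Rightarrow> complex) set \<Rightarrow> nat \<Rightarrow> diff_form set" where
  "diff_forms n X d = {w. \<forall>I\<in>index_sets n d. w I \<in> coord_ring n X}"

definition scale_form :: "((nat \<Rightarrow> complex) \<Rightarrow> complex) \<Rightarrow> diff_form \<Rightarrow> diff_form" where
  "scale_form g w = (\<lambda>I x. g x * w I x)"

definition complex_points :: "nat \<Rightarrow> (nat \<Rightarrow> complex) set \<Rightarrow> (nat \<Rightarrow> complex) topology" where
  "complex_points n X = subtopology (product_topology (\<lambda>_. euclidean) {..<n}) X"

text \<open>The coordinates \<open>t_1, \<dots>, t_d\<close> on the interior of the standard \<open>d\<close>-simplex; the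
  barycentric coordinate with index 0 is \<open>1 - t_1 - \<dots> - t_d\<close>.\<close>

definition open_simplex :: "nat \<Rightarrow> (nat \<Rightarrow> real) set" where
  "open_simplex d = {t \<in> {1..d} \<rightarrow>\<^sub>E UNIV. (\<forall>j\<in>{1..d}. 0 < t j) \<and> (\<Sum>j\<in>{1..d}. t j) < 1}"

definition simplex_pt :: "nat \<Rightarrow> (nat \<Rightarrow> real) \<Rightarrow> (nat \<Rightarrow> real)" where
  "simplex_pt d t = (\<lambda>i. if i = 0 then 1 - (\<Sum>j\<in>{1..d}. t j) else if i \<le> d then t i else 0)"

definition simplex_line ::
    "nat \<Rightarrow> ((nat \<Rightarrow> real) \<Rightarrow> nat \<Rightarrow> complex) \<Rightarrow> nat \<Rightarrow> nat \<Rightarrow> (nat \<Rightarrow> real) \<Rightarrow> real \<Rightarrow> complex" where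
  "simplex_line d s k j t h = s (simplex_pt d (t(j := h))) k"

definition simplex_partial ::
    "nat \<Rightarrow> ((nat \<Rightarrow> real) \<Rightarrow> nat \<Rightarrow> complex) \<Rightarrow> nat \<Rightarrow> nat \<Rightarrow> (nat \<Rightarrow> real) \<Rightarrow> complex" where
  "simplex_partial d s k j t = vector_derivative (simplex_line d s k j t) (at (t j))"

text \<open>The coefficient of \<open>dt_1 \<and> \<dots> \<and> dt_d\<close> in the pullback of \<open>dx_I\<close>.\<close>

definition jacobian_minor ::
    "nat \<Rightarrow> ((nat \<Rightarrow> real) \<Rightarrow> nat \<Rightarrow> complex) \<Rightarrow> nat set \<Rightarrow> (nat \<Rightarrow> real) \<Rightarrow> complex" where
  "jacobian_minor d s I t =
     Determinant.det (Matrix.mat d d (\<lambda>(i, j). simplex_partial d s (sorted_list_of_set I ! i) (Suc j) t))"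

definition pullback ::
    "nat \<Rightarrow> nat \<Rightarrow> diff_form \<Rightarrow> ((nat \<Rightarrow> real) \<Rightarrow> nat \<Rightarrow> complex) \<Rightarrow> (nat \<Rightarrow> real) \<Rightarrow> complex" where
  "pullback n d w s t = (\<Sum>I\<in>index_sets n d. w I (s (simplex_pt d t)) * jacobian_minor d s I t)"

abbreviation simplex_measure :: "nat \<Rightarrow> (nat \<Rightarrow> real) measure" where
  "simplex_measure d \<equiv> PiM {1..d} (\<lambda>_. lborel)"

text \<open>
  Simplices along which forms are integrated (they will also be singular, i.e. continuous on the
  closed simplex): continuously differentiable in the interior and of finite volume. Simplices
  that are continuously differentiable up to the boundary satisfy the latter condition, which
  makes the integrals of all regular forms absolutely convergent.
\<close>

definition integration_simplex ::
    "nat \<Rightarrow> nat \<Rightarrow> ((nat \<Rightarrow> real) \<Rightarrow> nat \<Rightarrow> complex) \<Rightarrow> bool" where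
  "integration_simplex n d s \<longleftrightarrow>
     (\<forall>k<n. \<forall>j\<in>{1..d}.
        (\<forall>t\<in>open_simplex d. simplex_line d s k j t differentiable (at (t j))) \<and>
        continuous_on (open_simplex d) (simplex_partial d s k j)) \<and>
     (\<forall>I\<in>index_sets n d. set_integrable (simplex_measure d) (open_simplex d) (jacobian_minor d s I))"

definition relative_chain :: "nat \<Rightarrow> nat \<Rightarrow> (nat \<Rightarrow> complex) set \<Rightarrow> (nat \<Rightarrow> complex) set
    \<Rightarrow> (nat \<Rightarrow> complex) chain \<Rightarrow> bool" where
  "relative_chain n d X Y \<sigma> \<longleftrightarrow> singular_relcycle d (complex_points n X) Y \<sigma> \<and>
     (\<forall>s\<in>Poly_Mapping.keys \<sigma>. integration_simplex n d s)"

definition chain_support :: "nat \<Rightarrow> (nat \<Rightarrow> complex) chain \<Rightarrow> (nat \<Rightarrow> complex) set" where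
  "chain_support d \<sigma> = (\<Union>s\<in>Poly_Mapping.keys \<sigma>. s ` standard_simplex d)"

text \<open>The density of \<open>w\<close> on the simplex \<open>s\<close> of \<open>\<sigma>\<close>, with the multiplicity (and hence the
  orientation) of \<open>s\<close> in \<open>\<sigma>\<close>.\<close>

definition form_density :: "nat \<Rightarrow> nat \<Rightarrow> (nat \<Rightarrow> complex) chain \<Rightarrow> diff_form
    \<Rightarrow> ((nat \<Rightarrow> real) \<Rightarrow> nat \<Rightarrow> complex) \<Rightarrow> (nat \<Rightarrow> real) \<Rightarrow> complex" where
  "form_density n d \<sigma> w s t = of_int (Poly_Mapping.lookup \<sigma> s) * pullback n d w s t"

definition chain_integral :: "nat \<Rightarrow> nat \<Rightarrow> (nat \<Rightarrow> complex) chain \<Rightarrow> diff_form \<Rightarrow> complex" where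
  "chain_integral n d \<sigma> w =
     (\<Sum>s\<in>Poly_Mapping.keys \<sigma>. LINT t:open_simplex d|simplex_measure d. form_density n d \<sigma> w s t)"

text \<open>The total mass \<open>\<integral>\<^sub>\<sigma> \<bar>w\<bar>\<close>. It bounds \<open>\<bar>\<integral>\<^sub>\<sigma> g w\<bar>\<close> by the maximum of \<open>\<bar>g\<bar>\<close>; the modulus
  of \<open>\<integral>\<^sub>\<sigma> w\<close> does not, unless the form is non-negative.\<close>

definition chain_mass :: "nat \<Rightarrow> nat \<Rightarrow> (nat \<Rightarrow> complex) chain \<Rightarrow> diff_form \<Rightarrow> real" where
  "chain_mass n d \<sigma> w =
     (\<Sum>s\<in>Poly_Mapping.keys \<sigma>. LINT t:open_simplex d|simplex_measure d. cmod (form_density n d \<sigma> w s t))"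

definition nonneg_on_chain :: "nat \<Rightarrow> nat \<Rightarrow> (nat \<Rightarrow> complex) chain \<Rightarrow> diff_form \<Rightarrow> bool" where
  "nonneg_on_chain n d \<sigma> w \<longleftrightarrow>
     (\<forall>s\<in>Poly_Mapping.keys \<sigma>. \<forall>t\<in>open_simplex d. form_density n d \<sigma> w s t \<in> \<real>\<^sub>\<ge>\<^sub>0)"

text \<open>Non-negativity alone allows the form to be zero on \<open>\<sigma>\<close>. Positivity of determinants also needs
  the points of \<open>\<sigma>\<close> where the form does not vanish to be Zariski dense in \<open>\<sigma>\<close>.\<close>

definition nonvanishing_locus ::
    "nat \<Rightarrow> nat \<Rightarrow> (nat \<Rightarrow> complex) chain \<Rightarrow> diff_form \<Rightarrow> (nat \<Rightarrow> complex) set" where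
  "nonvanishing_locus n d \<sigma> w =
     {s (simplex_pt d t) | s t. s \<in> Poly_Mapping.keys \<sigma> \<and> t \<in> open_simplex d \<and>
        form_density n d \<sigma> w s t \<noteq> 0}"

text \<open>On a chain where the form is non-negative, the total mass is just \<open>\<integral>\<^sub>\<sigma> w\<close>.\<close>

lemma chain_integral_eq_mass:
  assumes "nonneg_on_chain n d \<sigma> w"
  shows "chain_integral n d \<sigma> w = of_real (chain_mass n d \<sigma> w)"
proof -
  have "(LINT t:open_simplex d|simplex_measure d. form_density n d \<sigma> w s t) =
        of_real (LINT t:open_simplex d|simplex_measure d. cmod (form_density n d \<sigma> w s t))"
    if s: "s \<in> Poly_Mapping.keys \<sigma>" for s
  proof -
    have *: "form_density n d \<sigma> w s t = of_real (cmod (form_density n d \<sigma> w s t))"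
      if "t \<in> open_simplex d" for t
    proof -
      have "form_density n d \<sigma> w s t \<in> \<real>\<^sub>\<ge>\<^sub>0"
        using assms s that unfolding nonneg_on_chain_def by blast
      then show ?thesis
        by (auto elim!: nonneg_Reals_cases)
    qed
    have "indicat_real (open_simplex d) t *\<^sub>R form_density n d \<sigma> w s t =
        of_real (indicat_real (open_simplex d) t *\<^sub>R cmod (form_density n d \<sigma> w s t))" for t
      using *[of t] by (cases "t \<in> open_simplex d") auto
    then show ?thesis
      unfolding set_lebesgue_integral_def by (simp only: integral_complex_of_real)
  qed
  then show ?thesis
    unfolding chain_integral_def chain_mass_def by simp
qed

section \<open>The two determinants\<close>

text \<open>\<open>det_sup N g S\<close> is \<open>t_M(S)\<close> for the module \<open>M\<close> with basis \<open>g 0, \<dots>, g (N - 1)\<close>; a change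
  of integral basis multiplies the determinant by a sign.\<close>

definition det_sup :: "nat \<Rightarrow> (nat \<Rightarrow> (nat \<Rightarrow> complex) \<Rightarrow> complex) \<Rightarrow> (nat \<Rightarrow> complex) set \<Rightarrow> real" where
  "det_sup N g S =
     (SUP z\<in>{..<N} \<rightarrow>\<^sub>E S. cmod (Determinant.det (Matrix.mat N N (\<lambda>(i, j). g j (z i)))))"

definition period_matrix :: "nat \<Rightarrow> nat \<Rightarrow> (nat \<Rightarrow> complex) chain \<Rightarrow> diff_form \<Rightarrow> nat
    \<Rightarrow> (nat \<Rightarrow> (nat \<Rightarrow> complex) \<Rightarrow> complex) \<Rightarrow> complex Matrix.mat" where
  "period_matrix n d \<sigma> w N g =
     Matrix.mat N N (\<lambda>(i, j). chain_integral n d \<sigma> (scale_form (\<lambda>x. g i x * g j x) w))"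

end

theory Submission
  imports Defs "HOL-Computational_Algebra.Fundamental_Theorem_Algebra"
begin

text \<open>
  By Andreief's identity, \<open>N! det Q\<close> is the integral of \<open>det (g\<^sub>j(z\<^sub>i))\<^sup>2\<close> over \<open>\<sigma>\<^sup>N\<close>. Hence
  \<open>\<bar>det Q\<bar> \<le> m\<^sup>N t\<^sup>2 / N!\<close>, where \<open>m\<close> is the mass of the form, and \<open>m\<^sup>N < N!\<close> for large \<open>N\<close>.
  In the real case the identity also shows \<open>det Q \<ge> 0\<close>. If \<open>Q c = 0\<close>, then the integral of
  \<open>\<bar>\<Sum> c\<^sub>i g\<^sub>i\<bar>\<^sup>2\<close> vanishes, so \<open>\<Sum> c\<^sub>i g\<^sub>i\<close> is zero where the form is not, and by density on all
  of \<open>X\<close>. A complex relation of minimal length between rational functions on \<open>X\<close> with a coefficient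
  equal to 1 is rational: an irrational coefficient could be moved by an isomorphism of
  subrings of \<open>\<complex>\<close>, and the difference of the two relations would be shorter. Clearing denominators
  contradicts the independence of the integral basis.
\<close>

section \<open>Relations over the complex numbers descend to the rationals\<close>

text \<open>The obstacle is a mismatch of coefficients: independence of the basis is known only over
  the integers, whereas the kernel vector of a singular \<open>Q\<close> is complex. To bring its
  relation down to the rationals, one coefficient must be moved, and finitely many other
  coefficients and the coordinates of one point must be carried along. A partial isomorphism that is
  extended by one element at a time does this. The graphs connect subrings, not subfields: adjoining
  \<open>y\<close> then means taking all values of polynomials at \<open>y\<close>, with no
  quotients to form. The price is that leading coefficients cannot be inverted, so division with
  remainder becomes pseudo-division. A graph is single-valued and injective because it is closed
  under differences and pairs 0 with 0 only.\<close>

text \<open>\<open>R\<close> is the graph of an isomorphism between two countable subrings of the complex numbers.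
  Countability leaves room for transcendental elements when the isomorphism is extended.\<close>

definition ring_iso_graph :: "(complex \<times> complex) set \<Rightarrow> bool" where
  "ring_iso_graph R \<longleftrightarrow> countable R \<and> (\<forall>q\<in>\<rat>. (q, q) \<in> R) \<and>
     (\<forall>a a' b b'. (a, a') \<in> R \<longrightarrow> (b, b') \<in> R \<longrightarrow> (a + b, a' + b') \<in> R \<and> (a * b, a' * b') \<in> R) \<and>
     (\<forall>a a'. (a, a') \<in> R \<longrightarrow> (a = 0 \<longleftrightarrow> a' = 0))"

definition poly_pair :: "(complex \<times> complex) set \<Rightarrow> complex poly \<Rightarrow> complex poly \<Rightarrow> bool" where
  "poly_pair R P P' \<longleftrightarrow> (\<forall>i. (Polynomial.coeff P i, Polynomial.coeff P' i) \<in> R)"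

section \<open>Polynomials over the two subrings\<close>

context
  fixes R :: "(complex \<times> complex) set"
  assumes R: "ring_iso_graph R"
begin

lemma iso_Rats: "q \<in> \<rat> \<Longrightarrow> (q, q) \<in> R"
  and iso_add: "(a, a') \<in> R \<Longrightarrow> (b, b') \<in> R \<Longrightarrow> (a + b, a' + b') \<in> R"
  and iso_mult: "(a, a') \<in> R \<Longrightarrow> (b, b') \<in> R \<Longrightarrow> (a * b, a' * b') \<in> R"
  and iso_zero_iff: "(a, a') \<in> R \<Longrightarrow> a = 0 \<longleftrightarrow> a' = 0"
  and iso_countable: "countable R"
  using R unfolding ring_iso_graph_def by blast+

lemma iso_uminus: "(a, a') \<in> R \<Longrightarrow> (- a, - a') \<in> R"
  using iso_mult[of "- 1" "- 1" a a'] iso_Rats[of "- 1"] by simp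

lemma iso_diff: "(a, a') \<in> R \<Longrightarrow> (b, b') \<in> R \<Longrightarrow> (a - b, a' - b') \<in> R"
  using iso_add[OF _ iso_uminus] by fastforce

lemma iso_sum: "(\<And>i. i \<in> A \<Longrightarrow> (f i, f' i) \<in> R) \<Longrightarrow> (sum f A, sum f' A) \<in> R"
  by (induction A rule: infinite_finite_induct) (auto intro: iso_add iso_Rats)

lemma iso_prod: "(\<And>i. i \<in> A \<Longrightarrow> (f i, f' i) \<in> R) \<Longrightarrow> (prod f A, prod f' A) \<in> R"
  by (induction A rule: infinite_finite_induct) (auto intro: iso_mult iso_Rats)

lemma iso_power: "(a, a') \<in> R \<Longrightarrow> (a ^ k, a' ^ k) \<in> R"
  by (induction k) (auto intro: iso_mult iso_Rats)

lemma poly_pair_zero_iff: "poly_pair R P P' \<Longrightarrow> P = 0 \<longleftrightarrow> P' = 0"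
  unfolding poly_pair_def poly_eq_iff using iso_zero_iff by fastforce

lemma poly_pair_degree: "poly_pair R P P' \<Longrightarrow> degree P = degree P'"
proof -
  assume "poly_pair R P P'"
  then have "Polynomial.coeff P i = 0 \<longleftrightarrow> Polynomial.coeff P' i = 0" for i
    using iso_zero_iff by (auto simp: poly_pair_def)
  then show ?thesis by (simp add: Polynomial.degree_def)
qed

lemma poly_pair_lead: "poly_pair R P P' \<Longrightarrow> (lead_coeff P, lead_coeff P') \<in> R"
  using poly_pair_degree unfolding poly_pair_def by metis

lemma poly_pair_add: "poly_pair R P P' \<Longrightarrow> poly_pair R Q Q' \<Longrightarrow> poly_pair R (P + Q) (P' + Q')"
  unfolding poly_pair_def by (auto intro: iso_add)

lemma poly_pair_diff: "poly_pair R P P' \<Longrightarrow> poly_pair R Q Q' \<Longrightarrow> poly_pair R (P - Q) (P' - Q')"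
  unfolding poly_pair_def by (auto intro: iso_diff)

lemma poly_pair_mult: "poly_pair R P P' \<Longrightarrow> poly_pair R Q Q' \<Longrightarrow> poly_pair R (P * Q) (P' * Q')"
  unfolding poly_pair_def coeff_mult by (auto intro!: iso_sum iso_mult)

lemma poly_pair_monom: "(a, a') \<in> R \<Longrightarrow> poly_pair R (Polynomial.monom a k) (Polynomial.monom a' k)"
  unfolding poly_pair_def by (auto intro: iso_Rats)

lemma poly_pair_smult:
  "(a, a') \<in> R \<Longrightarrow> poly_pair R P P' \<Longrightarrow> poly_pair R (Polynomial.smult a P) (Polynomial.smult a' P')"
  unfolding poly_pair_def by (auto intro: iso_mult)

text \<open>A pair is coded by the list of its coefficient pairs, of one length for both since the
  degrees agree. The count keeps extended graphs countable and leaves a complex number that is a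
  root of no nonzero image polynomial.\<close>

lemma countable_poly_pairs: "countable {(P, P'). poly_pair R P P'}"
proof (rule countable_subset)
  show "{(P, P'). poly_pair R P P'} \<subseteq> (\<lambda>l. (Poly (map fst l), Poly (map snd l))) ` lists R"
  proof clarify
    fix P P' assume *: "poly_pair R P P'"
    define l where "l = map (\<lambda>i. (Polynomial.coeff P i, Polynomial.coeff P' i)) [0..<Suc (degree P)]"
    have "P = Poly (map fst l)"
      by (rule poly_eqI) (auto simp: l_def nth_default_def coeff_eq_0 simp del: upt_Suc)
    moreover have "P' = Poly (map snd l)"
      using poly_pair_degree[OF *]
      by (intro poly_eqI) (auto simp: l_def nth_default_def coeff_eq_0 simp del: upt_Suc)
    moreover have "l \<in> lists R"
      using * by (auto simp: l_def poly_pair_def)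
    ultimately show "(P, P') \<in> (\<lambda>l. (Poly (map fst l), Poly (map snd l))) ` lists R" by blast
  qed
  show "countable ((\<lambda>l. (Poly (map fst l), Poly (map snd l))) ` lists R)"
    using iso_countable by (intro countable_image) auto
qed

text \<open>The leading coefficient of \<open>F\<close> need not be invertible in the subring, so
  \<open>G\<close> is multiplied by it before each cancellation; \<open>a\<close> is a power of it.
  The same operations on the images keep the two divisions paired.\<close>

lemma poly_pair_pseudo_division:
  assumes F: "poly_pair R F F'" "F \<noteq> 0"
  shows "poly_pair R G G' \<Longrightarrow> \<exists>a a' H H' S S'. (a, a') \<in> R \<and> a \<noteq> 0 \<and> poly_pair R H H' \<and> poly_pair R S S' \<and>
    Polynomial.smult a G = F * H + S \<and> Polynomial.smult a' G' = F' * H' + S' \<and>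
    (S = 0 \<or> degree S < degree F)"
\<comment> \<open>The measure puts 0 below the nonzero constants, which have degree 0 too; otherwise
  a step from a constant to 0 would not count as a descent.\<close>
proof (induction "if G = 0 then 0 else Suc (degree G)" arbitrary: G G' rule: less_induct)
  case less
  note G = less.prems
  show ?case
  proof (cases "G = 0 \<or> degree G < degree F")
    case True
    have "poly_pair R 0 0" unfolding poly_pair_def by (auto intro: iso_Rats)
    then show ?thesis
      using True G iso_Rats[of 1] by (intro exI[of _ 1] exI[of _ 0] exI[of _ G] exI[of _ G']) auto
  next
    case False
    define k where "k = degree G - degree F"
    define lF lF' lG lG' where l: "lF = lead_coeff F" "lF' = lead_coeff F'"
      "lG = lead_coeff G" "lG' = lead_coeff G'"
    have lR: "(lF, lF') \<in> R" "(lG, lG') \<in> R"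
      using poly_pair_lead F G by (auto simp: l)
    define G1 where "G1 = Polynomial.smult lF G - Polynomial.monom lG k * F"
    define G1' where "G1' = Polynomial.smult lF' G' - Polynomial.monom lG' k * F'"
    have G1: "poly_pair R G1 G1'"
      unfolding G1_def G1'_def
      by (intro poly_pair_diff poly_pair_smult poly_pair_mult poly_pair_monom lR F G)
    have "Polynomial.coeff G1 i = 0" if "i \<ge> degree G" for i
    proof (cases "i = degree G")
      case True
      then show ?thesis using False by (auto simp: G1_def l k_def coeff_monom_mult)
    next
      case False
      with that have "i > degree G" by simp
      moreover have "i - k > degree F" using \<open>i > degree G\<close> \<open>\<not> (G = 0 \<or> degree G < degree F)\<close>
        by (auto simp: k_def)
      ultimately show ?thesis by (auto simp: G1_def coeff_monom_mult coeff_eq_0)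
    qed
    then have "G1 = 0 \<or> degree G1 < degree G"
      by (metis leading_coeff_0_iff not_le)
    then have "(if G1 = 0 then 0 else Suc (degree G1)) < (if G = 0 then 0 else Suc (degree G))"
      using False by auto
    from less.hyps[OF this G1] obtain a a' H H' S S' where *: "(a, a') \<in> R" "a \<noteq> 0"
      "poly_pair R H H'" "poly_pair R S S'" "Polynomial.smult a G1 = F * H + S"
      "Polynomial.smult a' G1' = F' * H' + S'" "S = 0 \<or> degree S < degree F"
      by blast
    have "Polynomial.smult (a * lF) G = F * (H + Polynomial.monom (a * lG) k) + S"
    proof -
      have "Polynomial.smult (a * lF) G = Polynomial.smult a G1 + F * Polynomial.smult a (Polynomial.monom lG k)"
        by (simp add: G1_def smult_diff_right mult.commute)
      then show ?thesis using *(5) by (simp add: smult_monom distrib_left)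
    qed
    moreover have "Polynomial.smult (a' * lF') G' = F' * (H' + Polynomial.monom (a' * lG') k) + S'"
    proof -
      have "Polynomial.smult (a' * lF') G' = Polynomial.smult a' G1' + F' * Polynomial.smult a' (Polynomial.monom lG' k)"
        by (simp add: G1'_def smult_diff_right mult.commute)
      then show ?thesis using *(6) by (simp add: smult_monom distrib_left)
    qed
    moreover have "(a * lF, a' * lF') \<in> R" "a * lF \<noteq> 0"
      using * lR F by (auto intro: iso_mult simp: l)
    moreover have "poly_pair R (H + Polynomial.monom (a * lG) k) (H' + Polynomial.monom (a' * lG') k)"
      using * lR by (intro poly_pair_add poly_pair_monom iso_mult)
    ultimately show ?thesis
      using *(4,7)
      by (intro exI[of _ "a * lF"] exI[of _ "a' * lF'"] exI[of _ "H + Polynomial.monom (a * lG) k"]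
          exI[of _ "H' + Polynomial.monom (a' * lG') k"] exI[of _ S] exI[of _ S'] conjI)
  qed
qed

text \<open>The values \<open>(poly P y, poly P' y')\<close> form the new graph, and the assumption
  is its zero condition. Constant polynomials recover \<open>R\<close>; the monomial of degree 1
  gives \<open>(y, y')\<close>.\<close>

lemma adjoin:
  assumes "\<And>P P'. poly_pair R P P' \<Longrightarrow> poly P y = 0 \<longleftrightarrow> poly P' y' = 0"
  shows "\<exists>R2. ring_iso_graph R2 \<and> R \<subseteq> R2 \<and> (y, y') \<in> R2"
proof -
  define R2 where "R2 = (\<lambda>(P, P'). (poly P y, poly P' y')) ` {(P, P'). poly_pair R P P'}"
  have mem: "(poly P y, poly P' y') \<in> R2" if "poly_pair R P P'" for P P'
    unfolding R2_def using that by auto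
  have sub: "R \<subseteq> R2"
  proof clarify
    fix a b assume "(a, b) \<in> R"
    then show "(a, b) \<in> R2" using mem[OF poly_pair_monom[of a b 0]] by (simp add: poly_monom)
  qed
  have "ring_iso_graph R2"
    unfolding ring_iso_graph_def
  proof (intro conjI allI impI ballI)
    show "countable R2" unfolding R2_def using countable_poly_pairs by auto
    show "(q, q) \<in> R2" if "q \<in> \<rat>" for q using iso_Rats sub that by auto
  next
    fix a a' b b' assume "(a, a') \<in> R2" "(b, b') \<in> R2"
    then obtain P P' Q Q' where "poly_pair R P P'" "poly_pair R Q Q'"
      "a = poly P y" "a' = poly P' y'" "b = poly Q y" "b' = poly Q' y'"
      unfolding R2_def by auto
    then show "(a + b, a' + b') \<in> R2" "(a * b, a' * b') \<in> R2"
      using mem[OF poly_pair_add[of P P' Q Q']] mem[OF poly_pair_mult[of P P' Q Q']] by auto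
  qed (use assms in \<open>auto simp: R2_def\<close>)
  moreover have "(y, y') \<in> R2"
    using mem[OF poly_pair_monom[of 1 1 1]] iso_Rats[of 1] by (simp add: poly_monom)
  ultimately show ?thesis using sub by blast
qed

text \<open>Countably many nonzero image polynomials have countably many roots, so some
  \<open>y'\<close> avoids them all. It is made to avoid \<open>y\<close> as well, so that a
  transcendental \<open>y\<close> can be moved. Both sides of the equivalence then say that the
  polynomial is 0.\<close>

lemma transcendental_conjugate:
  assumes y: "\<nexists>P P'. poly_pair R P P' \<and> P \<noteq> 0 \<and> poly P y = 0"
  shows "\<exists>y'. y' \<noteq> y \<and> (\<forall>P P'. poly_pair R P P' \<longrightarrow> (poly P y = 0 \<longleftrightarrow> poly P' y' = 0))"
proof -
  define B where "B = (\<Union>(P, P')\<in>{(P, P'). poly_pair R P P' \<and> P' \<noteq> 0}. {z. poly P' z = 0})"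
  have "countable {(P, P'). poly_pair R P P' \<and> P' \<noteq> 0}"
    by (rule countable_subset[OF _ countable_poly_pairs]) auto
  then have "countable B"
    unfolding B_def by (intro countable_UN) (auto intro!: countable_finite poly_roots_finite)
  then have "countable (insert y B)" by simp
  moreover have "uncountable (UNIV :: complex set)"
    using uncountable_UNIV_real
    by (metis countable_image_inj_on countable_subset inj_of_real subset_UNIV)
  ultimately obtain y' where y': "y' \<notin> insert y B" by (metis UNIV_eq_I)
  have "poly P y = 0 \<longleftrightarrow> poly P' y' = 0" if "poly_pair R P P'" for P P'
    using y poly_pair_zero_iff[OF that] y' that unfolding B_def by auto
  then show ?thesis using y' by blast
qed

text \<open>The remainder of \<open>G\<close> modulo a minimal annihilator \<open>F\<close> kills
  \<open>y\<close>, hence is 0 by minimality. Its image is then 0 too, and the paired division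
  evaluated at \<open>y'\<close> leaves \<open>a' * poly G' y' = 0\<close> with \<open>a'\<close>
  nonzero.\<close>

lemma annihilator_transfer:
  assumes F: "poly_pair R F F'" "F \<noteq> 0" "poly F y = 0" "poly F' y' = 0"
    and min: "\<And>P P'. poly_pair R P P' \<Longrightarrow> P \<noteq> 0 \<Longrightarrow> poly P y = 0 \<Longrightarrow> degree F \<le> degree P"
    and G: "poly_pair R G G'" "poly G y = 0"
  shows "poly G' y' = 0"
proof -
  from poly_pair_pseudo_division[OF F(1,2) G(1)] obtain a a' H H' S S' where
    *: "(a, a') \<in> R" "a \<noteq> 0" "poly_pair R S S'" "Polynomial.smult a G = F * H + S"
      "Polynomial.smult a' G' = F' * H' + S'" "S = 0 \<or> degree S < degree F" by blast
  from arg_cong[OF *(4), of "\<lambda>p. poly p y"] have "poly S y = 0"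
    using F(3) G(2) by simp
  then have "S = 0" using min[OF *(3)] *(6) by fastforce
  then have "S' = 0" using poly_pair_zero_iff[OF *(3)] by simp
  with arg_cong[OF *(5), of "\<lambda>p. poly p y'"] have "a' * poly G' y' = 0" using F(4) by simp
  then show ?thesis using iso_zero_iff[OF *(1)] *(2) by simp
qed

end

lemma ring_iso_graph_converse:
  assumes "ring_iso_graph R" shows "ring_iso_graph (R\<inverse>)"
proof -
  have "R\<inverse> = prod.swap ` R" by force
  then have "countable (R\<inverse>)"
    using assms by (simp add: ring_iso_graph_def)
  then show ?thesis using assms unfolding ring_iso_graph_def by auto
qed

lemma poly_pair_converse: "poly_pair (R\<inverse>) P P' \<longleftrightarrow> poly_pair R P' P"
  by (simp add: poly_pair_def)

lemma ex_minimal_annihilator: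
  assumes "poly_pair R P P'" "P \<noteq> 0" "poly P y = 0"
  obtains F F' where "poly_pair R F F'" "F \<noteq> 0" "poly F y = 0"
    "\<And>P P'. poly_pair R P P' \<Longrightarrow> P \<noteq> 0 \<Longrightarrow> poly P y = 0 \<Longrightarrow> degree F \<le> degree P"
proof -
  define A where "A E \<longleftrightarrow> (\<exists>E'. poly_pair R E E') \<and> E \<noteq> 0 \<and> poly E y = 0" for E
  have "A P" using assms unfolding A_def by blast
  from ex_has_least_nat[of A, OF this, of degree]
  obtain F where F: "A F" "\<forall>E. A E \<longrightarrow> degree F \<le> degree E" by blast
  then obtain F' where "poly_pair R F F'" unfolding A_def by blast
  then show ?thesis using that[of F F'] F unfolding A_def by blast
qed

text \<open>The forward direction is division by \<open>F\<close>. For the converse,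
  \<open>F'\<close> is not known to be minimal at \<open>y'\<close>, so it is divided by a minimal
  annihilator \<open>E'\<close> of \<open>y'\<close>: a multiple of \<open>F\<close> is
  \<open>E * H\<close>. As \<open>E'\<close> is not constant, \<open>H\<close> has smaller degree
  than \<open>F\<close>, so it is \<open>E\<close> that kills \<open>y\<close>. Division by
  \<open>E'\<close> along the converse graph then finishes.\<close>

lemma algebraic_conjugate:
  assumes R: "ring_iso_graph R"
    and F: "poly_pair R F F'" "F \<noteq> 0" "poly F y = 0" "poly F' y' = 0"
    and min: "\<And>P P'. poly_pair R P P' \<Longrightarrow> P \<noteq> 0 \<Longrightarrow> poly P y = 0 \<Longrightarrow> degree F \<le> degree P"
    and G: "poly_pair R G G'"
  shows "poly G y = 0 \<longleftrightarrow> poly G' y' = 0"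
proof
  show "poly G' y' = 0" if "poly G y = 0"
    using annihilator_transfer[OF R F min G that] .
next
  assume G': "poly G' y' = 0"
  have "F' \<noteq> 0" using F(2) poly_pair_zero_iff[OF R F(1)] by simp
  with F obtain E E' where E: "poly_pair R E E'" "E' \<noteq> 0" "poly E' y' = 0"
    and Emin: "\<And>P P'. poly_pair R P P' \<Longrightarrow> P' \<noteq> 0 \<Longrightarrow> poly P' y' = 0 \<Longrightarrow> degree E' \<le> degree P'"
    using ex_minimal_annihilator[of "R\<inverse>" F' F y'] unfolding poly_pair_converse by metis
  have E0: "E \<noteq> 0" using poly_pair_zero_iff[OF R E(1)] E(2) by simp
  from poly_pair_pseudo_division[OF R E(1) E0 F(1)] obtain a a' H H' S S' where
    *: "(a, a') \<in> R" "a \<noteq> 0" "poly_pair R H H'" "poly_pair R S S'" "Polynomial.smult a F = E * H + S"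
      "Polynomial.smult a' F' = E' * H' + S'" "S = 0 \<or> degree S < degree E" by blast
  from arg_cong[OF *(6), of "\<lambda>p. poly p y'"] have "poly S' y' = 0"
    using F(4) E(3) by simp
  then have "S' = 0" using Emin[OF *(4)] *(7) poly_pair_degree[OF R *(4)] poly_pair_degree[OF R E(1)]
      poly_pair_zero_iff[OF R *(4)] by fastforce
  then have "S = 0" using poly_pair_zero_iff[OF R *(4)] by simp
  with *(5) have aF: "Polynomial.smult a F = E * H" by simp
  have "H \<noteq> 0" using aF *(2) F(2) by auto
  have "degree F = degree E + degree H"
    using arg_cong[OF aF, of degree] *(2) E0 \<open>H \<noteq> 0\<close> by (simp add: degree_mult_eq)
  moreover have "degree E' \<noteq> 0"
    using E(2,3) by (metis degree_eq_zeroE mult_zero_right pCons_0_0 poly_pCons poly_0 add.right_neutral)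
  ultimately have "poly H y \<noteq> 0"
    using min[OF *(3) \<open>H \<noteq> 0\<close>] poly_pair_degree[OF R E(1)] by auto
  then have Ey: "poly E y = 0"
    using arg_cong[OF aF, of "\<lambda>p. poly p y"] F(3) by simp
  show "poly G y = 0"
    using annihilator_transfer[OF ring_iso_graph_converse[OF R], of E' E y' y G' G] E Ey Emin G G'
    by (simp add: poly_pair_converse)
qed

lemma complex_poly_root: "degree p \<noteq> 0 \<Longrightarrow> \<exists>z :: complex. poly p z = 0"
  using fundamental_theorem_of_algebra constant_degree by metis

lemma ring_iso_graph_extend:
  assumes R: "ring_iso_graph R"
  shows "\<exists>R2 y'. ring_iso_graph R2 \<and> R \<subseteq> R2 \<and> (y, y') \<in> R2"
proof (cases "\<exists>P P'. poly_pair R P P' \<and> P \<noteq> 0 \<and> poly P y = 0")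
  case True
  then obtain F F' where F: "poly_pair R F F'" "F \<noteq> 0" "poly F y = 0"
    and min: "\<And>P P'. poly_pair R P P' \<Longrightarrow> P \<noteq> 0 \<Longrightarrow> poly P y = 0 \<Longrightarrow> degree F \<le> degree P"
    using ex_minimal_annihilator by blast
  have "degree F \<noteq> 0"
    using F(2,3) by (metis degree_eq_zeroE mult_zero_right pCons_0_0 poly_pCons poly_0 add.right_neutral)
  then obtain y' where y': "poly F' y' = 0"
    using complex_poly_root poly_pair_degree[OF R F(1)] by metis
  have "poly P y = 0 \<longleftrightarrow> poly P' y' = 0" if "poly_pair R P P'" for P P'
    by (rule algebraic_conjugate[OF R F y' _ that]) (rule min)
  from adjoin[OF R this] show ?thesis by blast
next
  case False
  from transcendental_conjugate[OF R False]
  obtain y' where "\<And>P P'. poly_pair R P P' \<Longrightarrow> poly P y = 0 \<longleftrightarrow> poly P' y' = 0" by blast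
  from adjoin[OF R this] show ?thesis by blast
qed

lemma ring_iso_graph_extend_tuple:
  assumes "ring_iso_graph R"
  shows "\<exists>R2 x'. ring_iso_graph R2 \<and> R \<subseteq> R2 \<and> (\<forall>i<n::nat. (x i, x' i) \<in> R2)"
proof (induction n)
  case 0
  then show ?case using assms by auto
next
  case (Suc n)
  then obtain R2 x' where *: "ring_iso_graph R2" "R \<subseteq> R2" "\<forall>i<n. (x i, x' i) \<in> R2" by blast
  from ring_iso_graph_extend[OF *(1), of "x n"] obtain R3 y'
    where **: "ring_iso_graph R3" "R2 \<subseteq> R3" "(x n, y') \<in> R3" by blast
  have "\<forall>i<Suc n. (x i, (x'(n := y')) i) \<in> R3"
    using * ** by (auto simp: less_Suc_eq)
  then show ?case using * ** by blast
qed

lemma ring_iso_graph_Rats: "ring_iso_graph {(q, q) | q. q \<in> \<rat>}"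
proof -
  have "countable ((\<lambda>q :: complex. (q, q)) ` \<rat>)"
    by (intro countable_image) (simp add: Rats_def)
  moreover have "(\<lambda>q :: complex. (q, q)) ` \<rat> = {(q, q) | q. q \<in> \<rat>}" by auto
  ultimately show ?thesis unfolding ring_iso_graph_def by auto
qed

text \<open>Starting from the identity on the rationals, an algebraic \<open>y\<close> is sent to
  another root of its minimal polynomial \<open>F\<close>. There is one because \<open>F\<close> is
  not linear, \<open>y\<close> being irrational, and \<open>y\<close> is a simple root: the
  derivative has smaller degree, so by minimality it does not vanish at \<open>y\<close>.\<close>

lemma ring_iso_graph_moving:
  assumes y: "y \<notin> \<rat>"
  shows "\<exists>R y'. ring_iso_graph R \<and> (y, y') \<in> R \<and> y' \<noteq> y"
proof -
  define R :: "(complex \<times> complex) set" where "R = {(q, q) | q. q \<in> \<rat>}"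
  have R: "ring_iso_graph R" unfolding R_def by (rule ring_iso_graph_Rats)
  have same: "P' = P" if "poly_pair R P P'" for P P'
    using that by (auto simp: poly_pair_def R_def intro: poly_eqI)
  show ?thesis
  proof (cases "\<exists>P P'. poly_pair R P P' \<and> P \<noteq> 0 \<and> poly P y = 0")
    case True
    then obtain F F' where F: "poly_pair R F F'" "F \<noteq> 0" "poly F y = 0"
      and min: "\<And>P P'. poly_pair R P P' \<Longrightarrow> P \<noteq> 0 \<Longrightarrow> poly P y = 0 \<Longrightarrow> degree F \<le> degree P"
      using ex_minimal_annihilator by blast
    obtain H where H: "F = [:- y, 1:] * H" using F(3) by (auto simp: poly_eq_0_iff_dvd)
    have "H \<noteq> 0" using H F(2) by auto
    have dF: "degree F = Suc (degree H)" using \<open>H \<noteq> 0\<close> unfolding H by (subst degree_mult_eq) auto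
    have "poly_pair R (pderiv F) (pderiv F)"
      using F(1) same[OF F(1)] by (auto simp: poly_pair_def coeff_pderiv R_def)
    moreover have "pderiv F \<noteq> 0" using dF by (auto simp: pderiv_eq_0_iff)
    ultimately have "poly (pderiv F) y \<noteq> 0"
      using min[of "pderiv F" "pderiv F"] dF by (auto simp: degree_pderiv)
    moreover have "poly (pderiv F) y = poly H y"
      unfolding H pderiv_mult by (simp add: pderiv_pCons)
    ultimately have Hy: "poly H y \<noteq> 0" by simp
    have "degree H \<noteq> 0"
    proof
      assume "degree H = 0"
      then obtain a where a: "H = [:a:]" by (metis degree_eq_zeroE)
      have "F = [:- (a * y), a:]" unfolding H a by simp
      with F(1) have "\<forall>i. Polynomial.coeff [:- (a * y), a:] i \<in> \<rat>"
        unfolding poly_pair_def R_def by auto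
      from this[rule_format, of 0] this[rule_format, of 1] have "- (a * y) \<in> \<rat>" "a \<in> \<rat>" by auto
      then have "(a * y) / a \<in> \<rat>" by (intro Rats_divide) (simp_all only: Rats_minus_iff)
      then show False using y \<open>H \<noteq> 0\<close> a by auto
    qed
    then obtain z where z: "poly H z = 0" using complex_poly_root by blast
    then have F'z: "poly F' z = 0" and "z \<noteq> y" using Hy same[OF F(1)] unfolding H by auto
    have "poly P y = 0 \<longleftrightarrow> poly P' z = 0" if "poly_pair R P P'" for P P'
      by (rule algebraic_conjugate[OF R F F'z _ that]) (rule min)
    from adjoin[OF R this] \<open>z \<noteq> y\<close> show ?thesis by blast
  next
    case False
    from transcendental_conjugate[OF R False]
    obtain y' where "y' \<noteq> y" "\<And>P P'. poly_pair R P P' \<Longrightarrow> poly P y = 0 \<longleftrightarrow> poly P' y' = 0"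
      by blast
    from this(1) adjoin[OF R this(2)] show ?thesis by blast
  qed
qed

section \<open>Points and linear relations under partial isomorphisms\<close>

lemma peval_iso:
  assumes R: "ring_iso_graph R" and x: "\<forall>i<n. (x i, x' i) \<in> R" and p: "p \<in> polys_over \<rat> n"
  shows "(peval p x, peval p x') \<in> R"
  unfolding peval_def
proof (intro iso_sum[OF R] iso_mult[OF R] iso_prod[OF R] iso_power[OF R])
  fix m assume m: "m \<in> Poly_Mapping.keys p"
  show "(poly_mapping.lookup p m, poly_mapping.lookup p m) \<in> R"
    using p m by (auto simp: polys_over_def intro: iso_Rats[OF R])
  show "(x i, x' i) \<in> R" if "i \<in> Poly_Mapping.keys m" for i
    using p m x that by (auto simp: polys_over_def)
qed

text \<open>The equations of \<open>X\<close> have rational coefficients, which the isomorphism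
  fixes, so their values at \<open>x\<close> and \<open>x'\<close> correspond, and 0 corresponds to
  0 only.\<close>

lemma affine_variety_iso:
  assumes "ring_iso_graph R" "\<forall>i<n. (x i, x' i) \<in> R" "affine_variety n X" "x' \<in> X" "x \<in> affine_space n"
  shows "x \<in> X"
proof -
  from assms(3) obtain S where S: "S \<subseteq> polys_over \<rat> n"
    "X = {x \<in> affine_space n. \<forall>p\<in>S. peval p x = 0}" unfolding affine_variety_def by blast
  have "peval p x = 0" if "p \<in> S" for p
  proof -
    have "p \<in> polys_over \<rat> n" using that S(1) by blast
    from iso_zero_iff[OF assms(1) peval_iso[OF assms(1,2) this]]
    show ?thesis using that assms(4) unfolding S(2) by simp
  qed
  then show ?thesis using S(2) assms(5) by auto
qed

text \<open>The point \<open>x'\<close> is pulled back along an extension of the isomorphism to a point of \<open>X\<close>, so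
  only one given point, and no automorphism of \<open>\<complex>\<close>, is needed.\<close>

lemma conjugate_relation:
  assumes X: "affine_variety n X"
    and q: "\<And>i :: nat. i < N \<Longrightarrow> q i \<in> polys_over \<rat> n"
    and R: "ring_iso_graph R" and c': "\<forall>i<N. (c i, c' i) \<in> R"
    and rel: "\<And>x. x \<in> X \<Longrightarrow> (\<Sum>i<N. c i * peval (q i) x) = 0"
    and x: "x' \<in> X"
  shows "(\<Sum>i<N. c' i * peval (q i) x') = 0"
proof -
  \<comment> \<open>The given point lies on the target side, so it is the converse graph that is
    extended by its coordinates.\<close>
  from ring_iso_graph_extend_tuple[OF ring_iso_graph_converse[OF R], of n x'] obtain R2 x
    where R2: "ring_iso_graph R2" "R\<inverse> \<subseteq> R2" "\<forall>i<n. (x' i, x i) \<in> R2" by blast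
  \<comment> \<open>Points of \<open>affine_space n\<close> are extensional, but the tuple is
    arbitrary from index \<open>n\<close> on.\<close>
  define z where "z = restrict x {..<n}"
  have z: "\<forall>i<n. (z i, x' i) \<in> R2\<inverse>" using R2(3) by (auto simp: z_def)
  note R3 = ring_iso_graph_converse[OF R2(1)]
  have "z \<in> X" by (rule affine_variety_iso[OF R3 z X x]) (auto simp: z_def PiE_iff extensional_def)
  have "((\<Sum>i<N. c i * peval (q i) z), (\<Sum>i<N. c' i * peval (q i) x')) \<in> R2\<inverse>"
    using c' R2(2) q by (intro iso_sum[OF R3] iso_mult[OF R3] peval_iso[OF R3 z]) auto
  from iso_zero_iff[OF R3 this] show ?thesis using rel[OF \<open>z \<in> X\<close>] by simp
qed

lemma rational_relation:
  assumes X: "affine_variety n X"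
    and q: "\<And>i :: nat. i < N \<Longrightarrow> q i \<in> polys_over \<rat> n"
    and rel: "\<And>x. x \<in> X \<Longrightarrow> (\<Sum>i<N. c i * peval (q i) x) = 0"
    and c: "j < N" "c j \<noteq> 0"
  shows "\<exists>b. (\<forall>i<N. b i \<in> \<rat>) \<and> (\<exists>i<N. b i \<noteq> 0) \<and> (\<forall>x\<in>X. (\<Sum>i<N. b i * peval (q i) x) = 0)"
proof -
  define L where "L = (\<lambda>c. (\<exists>i<N. c i \<noteq> 0) \<and> (\<forall>x\<in>X. (\<Sum>i<N. c i * peval (q i) x) = 0))"
  define supp where "supp c = {i. i < N \<and> c i \<noteq> 0}" for c :: "nat \<Rightarrow> complex"
  have "L c" using rel c by (auto simp: L_def)
  from ex_has_least_nat[of L c "\<lambda>c. card (supp c)", OF this]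
  obtain a where a: "L a" and amin: "\<And>b. L b \<Longrightarrow> card (supp a) \<le> card (supp b)" by blast
  from a obtain k where k: "k < N" "a k \<noteq> 0" unfolding L_def by blast
  \<comment> \<open>A coefficient equal to 1 is fixed by every graph and will cancel in the
    difference.\<close>
  define b where "b i = a i / a k" for i
  have bk: "b k = 1" using k by (simp add: b_def)
  have brel: "(\<Sum>i<N. b i * peval (q i) x) = 0" if "x \<in> X" for x
    using a that by (simp add: L_def b_def flip: sum_divide_distrib)
  have supp_b: "supp b = supp a" using k by (auto simp: supp_def b_def)
  have "b l \<in> \<rat>" if l: "l < N" for l
  proof (rule ccontr)
    assume "b l \<notin> \<rat>"
    from ring_iso_graph_moving[OF this] obtain R y' where R: "ring_iso_graph R" "(b l, y') \<in> R" "y' \<noteq> b l"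
      by blast
    from ring_iso_graph_extend_tuple[OF R(1), of N b] obtain R2 b'
      where R2: "ring_iso_graph R2" "R \<subseteq> R2" "\<forall>i<N. (b i, b' i) \<in> R2" by blast
    \<comment> \<open>The pair \<open>(0, v - v')\<close> lies in the graph. Single-valuedness
      identifies \<open>b' l\<close> with the moved value \<open>y'\<close>.\<close>
    have uniq: "v = v'" if "(u, v) \<in> R2" "(u, v') \<in> R2" for u v v'
      using iso_diff[OF R2(1) that] iso_zero_iff[OF R2(1)] by fastforce
    have b'l: "b' l \<noteq> b l" using uniq[of "b l" "b' l" y'] R R2 l by auto
    have b'k: "b' k = 1" using uniq[of 1 "b' k" 1] R2(3) k bk iso_Rats[OF R2(1), of 1] by auto
    have b'rel: "(\<Sum>i<N. b' i * peval (q i) x) = 0" if "x \<in> X" for x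
      by (rule conjugate_relation[OF X q R2(1,3) brel that])
    have "L (\<lambda>i. b i - b' i)"
      unfolding L_def using b'l l brel b'rel by (auto simp: algebra_simps sum_subtractf)
    then have "card (supp a) \<le> card (supp (\<lambda>i. b i - b' i))" by (rule amin)
    \<comment> \<open>Index \<open>k\<close> drops out because both coefficients are 1, and
      coefficients that were 0 stay 0; index \<open>l\<close> has kept the difference
      nontrivial.\<close>
    moreover have "supp (\<lambda>i. b i - b' i) \<subset> supp a"
    proof
      have "b' i = 0" if "i < N" "b i = 0" for i
        using that R2(3) iso_zero_iff[OF R2(1), of "b i" "b' i"] by simp
      then show "supp (\<lambda>i. b i - b' i) \<subseteq> supp a"
        unfolding supp_b[symmetric] by (auto simp: supp_def)
      have "k \<in> supp a" "k \<notin> supp (\<lambda>i. b i - b' i)"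
        using k bk b'k by (simp_all add: supp_def)
      then show "supp (\<lambda>i. b i - b' i) \<noteq> supp a" by blast
    qed
    then have "card (supp (\<lambda>i. b i - b' i)) < card (supp a)"
      by (intro psubset_card_mono) (auto simp: supp_def)
    ultimately show False by simp
  qed
  then show ?thesis using brel k bk by (intro exI[of _ b]) auto
qed

section \<open>Polynomial functions\<close>

text \<open>Only values at points matter for a reduced variety, so closure under sums, products and
  composition is recorded for functions instead of formal polynomials.\<close>

definition poly_fun :: "complex set \<Rightarrow> nat \<Rightarrow> ((nat \<Rightarrow> complex) \<Rightarrow> complex) \<Rightarrow> bool" where
  "poly_fun K n u \<longleftrightarrow> (\<exists>p\<in>polys_over K n. u = peval p)"

definition complex_subring :: "complex set \<Rightarrow> bool" where
  "complex_subring K \<longleftrightarrow> 0 \<in> K \<and> 1 \<in> K \<and> (\<forall>a\<in>K. \<forall>b\<in>K. a + b \<in> K \<and> a * b \<in> K)"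

lemma complex_subring_Rats: "complex_subring \<rat>" and complex_subring_UNIV: "complex_subring UNIV"
  by (auto simp: complex_subring_def)

lemma peval_add: "peval (p + q) x = peval p x + peval q x"
  unfolding peval_def
  by (rule setsum_keys_plus_distrib) (auto simp: distrib_right)

lemma peval_single: "peval (Poly_Mapping.single m a) x = a * (\<Prod>i\<in>Poly_Mapping.keys m. x i ^ poly_mapping.lookup m i)"
  by (simp add: peval_def)

lemma peval_cong:
  assumes "p \<in> polys_over K n" "\<And>k. k < n \<Longrightarrow> x k = y k"
  shows "peval p x = peval p y"
  unfolding peval_def
proof (intro sum.cong arg_cong2[where f = "(*)"] prod.cong refl)
  fix m i assume "m \<in> Poly_Mapping.keys p" "i \<in> Poly_Mapping.keys m"
  then have "i < n" using assms(1) by (auto simp: polys_over_def)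
  then show "x i ^ poly_mapping.lookup m i = y i ^ poly_mapping.lookup m i" using assms(2) by simp
qed

lemma polys_over_mono: "K \<subseteq> L \<Longrightarrow> polys_over K n \<subseteq> polys_over L n"
  by (auto simp: polys_over_def)

lemma poly_fun_peval: "p \<in> polys_over K n \<Longrightarrow> poly_fun K n (peval p)"
  by (auto simp: poly_fun_def)

context
  fixes K :: "complex set"
  assumes K: "complex_subring K"
begin

lemma poly_fun_zero: "poly_fun K n (\<lambda>x. 0)"
  unfolding poly_fun_def by (intro bexI[of _ 0]) (auto simp: peval_def polys_over_def)

lemma poly_fun_single:
  assumes "a \<in> K" "Poly_Mapping.keys m \<subseteq> {..<n}"
  shows "poly_fun K n (\<lambda>x. a * (\<Prod>i\<in>Poly_Mapping.keys m. x i ^ poly_mapping.lookup m i))"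
  unfolding poly_fun_def
  using assms by (intro bexI[of _ "Poly_Mapping.single m a"]) (auto simp: peval_single polys_over_def)

lemma poly_fun_const: "a \<in> K \<Longrightarrow> poly_fun K n (\<lambda>x. a)"
  using poly_fun_single[of a 0 n] by simp

lemma poly_fun_add:
  assumes "poly_fun K n u" "poly_fun K n v"
  shows "poly_fun K n (\<lambda>x. u x + v x)"
proof -
  from assms obtain p q where p: "p \<in> polys_over K n" "u = peval p" and q: "q \<in> polys_over K n" "v = peval q"
    unfolding poly_fun_def by blast
  have coeff: "poly_mapping.lookup f m \<in> K" if "f \<in> polys_over K n" for f m
    using that K by (cases "m \<in> Poly_Mapping.keys f") (auto simp: polys_over_def complex_subring_def in_keys_iff)
  have "p + q \<in> polys_over K n"
    unfolding polys_over_def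
  proof (clarify, intro conjI)
    fix m assume "m \<in> Poly_Mapping.keys (p + q)"
    with keys_add[of p q] have "m \<in> Poly_Mapping.keys p \<or> m \<in> Poly_Mapping.keys q" by blast
    then show "Poly_Mapping.keys m \<subseteq> {..<n}" using p(1) q(1) by (auto simp: polys_over_def)
    show "poly_mapping.lookup (p + q) m \<in> K"
      using coeff[OF p(1)] coeff[OF q(1)] K by (auto simp: lookup_add complex_subring_def)
  qed
  then show ?thesis
    unfolding poly_fun_def using p q by (intro bexI[of _ "p + q"]) (auto simp: peval_add)
qed

lemma poly_fun_sum: "(\<And>i. i \<in> A \<Longrightarrow> poly_fun K n (u i)) \<Longrightarrow> poly_fun K n (\<lambda>x. \<Sum>i\<in>A. u i x)"
  by (induction A rule: infinite_finite_induct) (auto intro: poly_fun_zero poly_fun_add)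

lemma poly_fun_mult:
  assumes "poly_fun K n u" "poly_fun K n v"
  shows "poly_fun K n (\<lambda>x. u x * v x)"
proof -
  from assms obtain p q where p: "p \<in> polys_over K n" "u = peval p" and q: "q \<in> polys_over K n" "v = peval q"
    unfolding poly_fun_def by blast
  let ?mono = "\<lambda>m x. \<Prod>i\<in>Poly_Mapping.keys m. x i ^ poly_mapping.lookup m i :: complex"
  \<comment> \<open>The three monomials run over different sets of variables; all are extended to
    the union, where a missing variable has exponent 0.\<close>
  have mono_add: "?mono (m + m') x = ?mono m x * ?mono m' x" for m m' x
  proof -
    let ?A = "Poly_Mapping.keys m \<union> Poly_Mapping.keys m'"
    have *: "?mono l x = (\<Prod>i\<in>?A. x i ^ poly_mapping.lookup l i)" if "Poly_Mapping.keys l \<subseteq> ?A" for l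
      by (rule prod.mono_neutral_left) (use that in \<open>auto simp: in_keys_iff\<close>)
    show ?thesis
      unfolding *[OF keys_add] *[OF Un_upper1] *[OF Un_upper2]
      by (simp add: lookup_add power_add prod.distrib)
  qed
  have "poly_fun K n (\<lambda>x. \<Sum>m\<in>Poly_Mapping.keys p. \<Sum>m'\<in>Poly_Mapping.keys q.
      (poly_mapping.lookup p m * poly_mapping.lookup q m') * ?mono (m + m') x)"
  proof (intro poly_fun_sum poly_fun_single)
    fix m m' assume m: "m \<in> Poly_Mapping.keys p" "m' \<in> Poly_Mapping.keys q"
    then show "poly_mapping.lookup p m * poly_mapping.lookup q m' \<in> K"
      using p q K by (auto simp: polys_over_def complex_subring_def)
    show "Poly_Mapping.keys (m + m') \<subseteq> {..<n}"
      using m p(1) q(1) keys_add[of m m'] by (fastforce simp: polys_over_def)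
  qed
  also have "(\<lambda>x. \<Sum>m\<in>Poly_Mapping.keys p. \<Sum>m'\<in>Poly_Mapping.keys q.
      (poly_mapping.lookup p m * poly_mapping.lookup q m') * ?mono (m + m') x) = (\<lambda>x. u x * v x)"
    by (simp add: p q peval_def sum_product mono_add algebra_simps)
  finally show ?thesis .
qed

lemma poly_fun_power: "poly_fun K n u \<Longrightarrow> poly_fun K n (\<lambda>x. u x ^ k)"
  using K by (induction k) (auto intro: poly_fun_mult poly_fun_const simp: complex_subring_def)

lemma poly_fun_prod: "(\<And>i. i \<in> A \<Longrightarrow> poly_fun K n (u i)) \<Longrightarrow> poly_fun K n (\<lambda>x. \<Prod>i\<in>A. u i x)"
  using K by (induction A rule: infinite_finite_induct)
    (auto intro: poly_fun_mult poly_fun_const simp: complex_subring_def)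

lemma poly_fun_compose:
  assumes "p \<in> polys_over K r" "\<And>k. k < r \<Longrightarrow> poly_fun K n (u k)"
  shows "poly_fun K n (\<lambda>x. peval p (\<lambda>k. u k x))"
  unfolding peval_def
proof (intro poly_fun_sum poly_fun_mult poly_fun_const poly_fun_prod poly_fun_power)
  fix m assume m: "m \<in> Poly_Mapping.keys p"
  then show "poly_mapping.lookup p m \<in> K" using assms(1) by (auto simp: polys_over_def)
  show "poly_fun K n (u i)" if "i \<in> Poly_Mapping.keys m" for i
    using assms m that by (auto simp: polys_over_def)
qed

end

lemma common_denominator:
  "(\<And>i. i < N \<Longrightarrow> b i \<in> \<rat>) \<Longrightarrow> \<exists>D :: int. D \<noteq> 0 \<and> (\<forall>i<N::nat. of_int D * (b i :: complex) \<in> \<int>)"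
proof (induction N)
  case 0
  show ?case by (intro exI[of _ 1]) auto
next
  case (Suc N)
  then obtain D :: int where D: "D \<noteq> 0" "\<forall>i<N. of_int D * b i \<in> \<int>" by auto
  from Suc.prems[of N] obtain a e :: int where e: "e > 0" "b N = of_int a / of_int e"
    by (auto elim!: Rats_cases')
  have "of_int (D * e) * b i \<in> \<int>" if "i < Suc N" for i
  proof (cases "i = N")
    case True
    then have "of_int (D * e) * b i = of_int (D * a)" using e by simp
    then show ?thesis by (metis Ints_of_int)
  next
    case False
    then have "of_int e * (of_int D * b i) \<in> \<int>"
      using D that by (intro Ints_mult[of _ "of_int D * b i"]) auto
    then show ?thesis by (simp add: mult_ac)
  qed
  then show ?case using D e by (intro exI[of _ "D * e"]) auto
qed

section \<open>Iterated integration of squared determinants\<close>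

text \<open>The square of \<open>det (g j (z i))\<close> after integration over the variables \<open>z 0, \<dots>, z (k - 1)\<close>.
  As it is a finite sum of products of functions of one variable, the variables can be integrated one
  at a time by a linear functional, and no product measure is needed.\<close>

definition kernel_sum :: "(nat \<Rightarrow> nat \<Rightarrow> complex) \<Rightarrow> (nat \<Rightarrow> 'a \<Rightarrow> complex) \<Rightarrow> nat \<Rightarrow> nat \<Rightarrow> (nat \<Rightarrow> 'a) \<Rightarrow> complex" where
  "kernel_sum q g N k z = (\<Sum>(\<pi>, \<rho>)\<in>{\<pi>. \<pi> permutes {0..<N}} \<times> {\<rho>. \<rho> permutes {0..<N}}.
     signof \<pi> * signof \<rho> * (\<Prod>m\<in>{0..<N}. if m < k then q (\<pi> m) (\<rho> m) else g (\<pi> m) (z m) * g (\<rho> m) (z m)))"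

lemma kernel_sum_0:
  "kernel_sum q g N 0 z = (Determinant.det (Matrix.mat N N (\<lambda>(i, j). g j (z i))))\<^sup>2"
proof -
  have "Determinant.det (Matrix.mat N N (\<lambda>(i, j). g j (z i))) =
      (\<Sum>\<pi> | \<pi> permutes {0..<N}. signof \<pi> * (\<Prod>m\<in>{0..<N}. g (\<pi> m) (z m)))"
    by (subst det_def') (auto intro!: sum.cong prod.cong simp: permutes_in_image)
  then show ?thesis
    unfolding kernel_sum_def power2_eq_square
    by (simp add: sum_product sum.cartesian_product prod.distrib algebra_simps)
qed

text \<open>For fixed \<open>\<pi>\<close> the sum over \<open>\<rho>\<close> is the Leibniz
  expansion of the matrix with rows permuted by \<open>\<pi>\<close>, that is, the sign of
  \<open>\<pi>\<close> times the determinant. The two signs cancel, and there are \<open>N!\<close>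
  choices of \<open>\<pi>\<close>.\<close>

lemma kernel_sum_N:
  "kernel_sum q g N N z = fact N * Determinant.det (Matrix.mat N N (\<lambda>(i, j). q i j))"
proof -
  let ?P = "{\<pi>. \<pi> permutes {0..<N}}"
  let ?Q = "Matrix.mat N N (\<lambda>(i, j). q i j)"
  have "kernel_sum q g N N z = (\<Sum>\<pi>\<in>?P. signof \<pi> * (\<Sum>\<rho>\<in>?P. signof \<rho> * (\<Prod>m\<in>{0..<N}. q (\<pi> m) (\<rho> m))))"
    unfolding kernel_sum_def sum.cartesian_product[symmetric]
    by (simp add: sum_distrib_left mult.assoc)
  also have "\<dots> = (\<Sum>\<pi>\<in>?P. Determinant.det ?Q)"
  proof (rule sum.cong)
    fix \<pi> assume "\<pi> \<in> ?P"
    then have \<pi>: "\<pi> permutes {0..<N}" by simp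
    have "(\<Sum>\<rho>\<in>?P. signof \<rho> * (\<Prod>m\<in>{0..<N}. q (\<pi> m) (\<rho> m))) =
        Determinant.det (Matrix.mat N N (\<lambda>(i, j). ?Q $$ (\<pi> i, j)))"
      using \<pi> by (subst det_def'[where n = N]) (auto intro!: sum.cong prod.cong simp: permutes_in_image)
    also have "\<dots> = signof \<pi> * Determinant.det ?Q"
      by (subst Determinant.det_permute_rows[OF _ \<pi>]) auto
    finally show "signof \<pi> * (\<Sum>\<rho>\<in>?P. signof \<rho> * (\<Prod>m\<in>{0..<N}. q (\<pi> m) (\<rho> m))) = Determinant.det ?Q"
      by (simp add: sign_def)
  qed simp
  also have "\<dots> = fact N * Determinant.det ?Q"
    using card_permutations[of "{0..<N}" N] by simp
  finally show ?thesis .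
qed

text \<open>The variable \<open>z k\<close> enters each summand only through one product of two
  values \<open>g i (z k)\<close>. Linearity of \<open>I\<close> is therefore demanded only for
  finite combinations of such products, for which integrability can be verified.\<close>

lemma kernel_sum_Suc:
  fixes I :: "('a \<Rightarrow> complex) \<Rightarrow> complex"
  assumes lin: "\<And>(A :: ((nat \<Rightarrow> nat) \<times> (nat \<Rightarrow> nat)) set) c i j. finite A \<Longrightarrow> (\<And>a. a \<in> A \<Longrightarrow> i a < N \<and> j a < N) \<Longrightarrow>
      I (\<lambda>x. \<Sum>a\<in>A. c a * (g (i a) x * g (j a) x)) = (\<Sum>a\<in>A. c a * q (i a) (j a))"
    and k: "k < N"
  shows "kernel_sum q g N (Suc k) z = I (\<lambda>y. kernel_sum q g N k (z(k := y)))"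
proof -
  let ?A = "{\<pi>. \<pi> permutes {0..<N}} \<times> {\<rho>. \<rho> permutes {0..<N}}"
  define c where "c a = (case a of (\<pi>, \<rho>) \<Rightarrow> signof \<pi> * signof \<rho> * (\<Prod>m\<in>{0..<N} - {k}.
    if m < k then q (\<pi> m) (\<rho> m) else g (\<pi> m) (z m) * g (\<rho> m) (z m)))" for a :: "(nat \<Rightarrow> nat) \<times> (nat \<Rightarrow> nat)"
  have "kernel_sum q g N k (z(k := y)) = (\<Sum>a\<in>?A. c a * (g (fst a k) y * g (snd a k) y))" for y
    unfolding kernel_sum_def
  proof (rule sum.cong[OF refl], clarify)
    fix \<pi> \<rho>
    have "(\<Prod>m\<in>{0..<N}. if m < k then q (\<pi> m) (\<rho> m) else g (\<pi> m) ((z(k := y)) m) * g (\<rho> m) ((z(k := y)) m)) =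
       g (\<pi> k) y * g (\<rho> k) y * (\<Prod>m\<in>{0..<N} - {k}. if m < k then q (\<pi> m) (\<rho> m) else g (\<pi> m) ((z(k := y)) m) * g (\<rho> m) ((z(k := y)) m))"
      using k by (subst prod.remove[of _ k]) auto
    also have "(\<Prod>m\<in>{0..<N} - {k}. if m < k then q (\<pi> m) (\<rho> m) else g (\<pi> m) ((z(k := y)) m) * g (\<rho> m) ((z(k := y)) m)) =
      (\<Prod>m\<in>{0..<N} - {k}. if m < k then q (\<pi> m) (\<rho> m) else g (\<pi> m) (z m) * g (\<rho> m) (z m))"
      by (rule prod.cong) auto
    finally show "signof \<pi> * signof \<rho> * (\<Prod>m\<in>{0..<N}. if m < k then q (\<pi> m) (\<rho> m) else g (\<pi> m) ((z(k := y)) m) * g (\<rho> m) ((z(k := y)) m)) =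
      c (\<pi>, \<rho>) * (g (fst (\<pi>, \<rho>) k) y * g (snd (\<pi>, \<rho>) k) y)"
      by (simp add: c_def)
  qed
  then have "I (\<lambda>y. kernel_sum q g N k (z(k := y))) = (\<Sum>a\<in>?A. c a * q (fst a k) (snd a k))"
    using k permutes_in_image[of _ "{0..<N}" k] lin[of ?A "\<lambda>a. fst a k" "\<lambda>a. snd a k" c]
    by (auto simp: finite_permutations)
  also have "\<dots> = kernel_sum q g N (Suc k) z"
    unfolding kernel_sum_def
  proof (rule sum.cong[OF refl], clarify)
    fix \<pi> \<rho>
    have "(\<Prod>m\<in>{0..<N}. if m < Suc k then q (\<pi> m) (\<rho> m) else g (\<pi> m) (z m) * g (\<rho> m) (z m)) =
       q (\<pi> k) (\<rho> k) * (\<Prod>m\<in>{0..<N} - {k}. if m < Suc k then q (\<pi> m) (\<rho> m) else g (\<pi> m) (z m) * g (\<rho> m) (z m))"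
      using k by (subst prod.remove[of _ k]) auto
    also have "(\<Prod>m\<in>{0..<N} - {k}. if m < Suc k then q (\<pi> m) (\<rho> m) else g (\<pi> m) (z m) * g (\<rho> m) (z m)) =
      (\<Prod>m\<in>{0..<N} - {k}. if m < k then q (\<pi> m) (\<rho> m) else g (\<pi> m) (z m) * g (\<rho> m) (z m))"
      by (rule prod.cong) auto
    finally show "c (\<pi>, \<rho>) * q (fst (\<pi>, \<rho>) k) (snd (\<pi>, \<rho>) k) =
      signof \<pi> * signof \<rho> * (\<Prod>m\<in>{0..<N}. if m < Suc k then q (\<pi> m) (\<rho> m) else g (\<pi> m) (z m) * g (\<rho> m) (z m))"
      by (simp add: c_def)
  qed
  finally show ?thesis by simp
qed

text \<open>Andreief's identity as an induction rule: \<open>P k\<close> is a property of values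
  after \<open>k\<close> integrations. It serves both for a bound that gains one factor per
  integration and for non-negativity.\<close>

lemma andreief_induct:
  fixes I :: "('a \<Rightarrow> complex) \<Rightarrow> complex"
  assumes lin: "\<And>(A :: ((nat \<Rightarrow> nat) \<times> (nat \<Rightarrow> nat)) set) c i j. finite A \<Longrightarrow> (\<And>a. a \<in> A \<Longrightarrow> i a < N \<and> j a < N) \<Longrightarrow>
      I (\<lambda>x. \<Sum>a\<in>A. c a * (g (i a) x * g (j a) x)) = (\<Sum>a\<in>A. c a * q (i a) (j a))"
    and base: "\<And>z. z \<in> {..<N} \<rightarrow>\<^sub>E S \<Longrightarrow> P 0 ((Determinant.det (Matrix.mat N N (\<lambda>(i, j). g j (z i))))\<^sup>2)"
    and step: "\<And>k u. (\<And>y. y \<in> S \<Longrightarrow> P k (u y)) \<Longrightarrow> P (Suc k) (I u)"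
  shows "P N (fact N * Determinant.det (Matrix.mat N N (\<lambda>(i, j). q i j)))"
proof -
  have "(\<forall>m\<in>{k..<N}. z m \<in> S) \<Longrightarrow> P k (kernel_sum q g N k z)" if "k \<le> N" for k z
    using that
  proof (induction k arbitrary: z)
    case 0
    \<comment> \<open>The assumption \<open>base\<close> concerns extensional tuples, whereas the
      induction updates arbitrary ones; the determinant sees only the indices below
      \<open>N\<close>.\<close>
    define z' where "z' = restrict z {..<N}"
    have "Matrix.mat N N (\<lambda>(i, j). g j (z i)) = Matrix.mat N N (\<lambda>(i, j). g j (z' i))"
      by (rule eq_matI) (auto simp: z'_def)
    moreover have "z' \<in> {..<N} \<rightarrow>\<^sub>E S" using 0 by (auto simp: z'_def)
    ultimately show ?case using base[of z'] by (simp add: kernel_sum_0)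
  next
    case (Suc k)
    have "P k (kernel_sum q g N k (z(k := y)))" if "y \<in> S" for y
      using Suc.prems that by (intro Suc.IH) auto
    then have "P (Suc k) (I (\<lambda>y. kernel_sum q g N k (z(k := y))))" by (rule step)
    moreover have "kernel_sum q g N (Suc k) z = I (\<lambda>y. kernel_sum q g N k (z(k := y)))"
      by (rule kernel_sum_Suc) (rule lin, assumption, blast, use Suc.prems in simp)
    ultimately show ?case by simp
  qed
  from this[of N] show ?thesis by (simp add: kernel_sum_N)
qed

section \<open>Integration over the open simplex and over chains\<close>

lemma simplex_pt_in_standard_simplex:
  assumes "t \<in> open_simplex d" shows "simplex_pt d t \<in> standard_simplex d"
proof -
  have pos: "0 < t j" if "j \<in> {1..d}" for j using assms that by (auto simp: open_simplex_def)
  have less: "(\<Sum>j\<in>{1..d}. t j) < 1" using assms by (auto simp: open_simplex_def)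
  have "t i \<le> (\<Sum>j\<in>{1..d}. t j)" if "i \<in> {1..d}" for i
    by (rule member_le_sum) (use that pos in \<open>auto intro: less_imp_le\<close>)
  then have le: "t i \<le> 1" if "i \<in> {1..d}" for i using that less by force
  have nonneg: "0 \<le> (\<Sum>j\<in>{1..d}. t j)" using pos by (intro sum_nonneg) (auto intro: less_imp_le)
  have "{..d} = insert 0 {1..d}" by auto
  then have "(\<Sum>i\<le>d. simplex_pt d t i) = simplex_pt d t 0 + (\<Sum>i\<in>{1..d}. simplex_pt d t i)" by simp
  also have "(\<Sum>i\<in>{1..d}. simplex_pt d t i) = (\<Sum>i\<in>{1..d}. t i)"
    by (rule sum.cong) (auto simp: simplex_pt_def)
  finally have "(\<Sum>i\<le>d. simplex_pt d t i) = 1" by (simp add: simplex_pt_def)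
  moreover have "0 \<le> simplex_pt d t i \<and> simplex_pt d t i \<le> 1" for i
    using nonneg less le[of i] pos[of i] by (auto simp: simplex_pt_def intro: less_imp_le)
  ultimately show ?thesis by (auto simp: standard_simplex_def simplex_pt_def)
qed

lemma continuous_simplex_pt: "continuous_on A (simplex_pt d)"
proof (rule continuous_on_coordinatewise_then_product)
  fix i
  show "continuous_on A (\<lambda>t. simplex_pt d t i)"
    unfolding simplex_pt_def
    by (cases "i = 0"; cases "i \<le> d")
      (auto intro!: continuous_intros continuous_on_subset[OF continuous_on_product_coordinates])
qed

lemma open_simplex_sets: "open_simplex d \<in> sets (simplex_measure d)"
proof -
  have "open_simplex d = {t \<in> space (simplex_measure d). (\<forall>j\<in>{1..d}. 0 < t j) \<and> (\<Sum>j\<in>{1..d}. t j) < 1}"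
    by (auto simp: open_simplex_def space_PiM)
  also have "\<dots> \<in> sets (simplex_measure d)" by measurable
  finally show ?thesis .
qed

text \<open>Continuity refers to the product topology on all functions \<open>nat => real\<close>,
  measurability to the product over \<open>{1..d}\<close>. They fit together because points of the
  latter are \<open>undefined\<close> at all other indices.\<close>

lemma ident_measurable_simplex: "(\<lambda>t. t) \<in> measurable (simplex_measure d) borel"
proof (rule measurable_coordinatewise_then_product)
  fix i
  show "(\<lambda>t. t i) \<in> borel_measurable (simplex_measure d)"
  proof (cases "i \<in> {1..d}")
    case True
    then show ?thesis by measurable
  next
    case False
    then have "t i = undefined" if "t \<in> space (simplex_measure d)" for t
      using that by (auto simp: space_PiM PiE_def extensional_def)
    then show ?thesis by (subst measurable_cong[where g = "\<lambda>_. undefined"]) auto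
  qed
qed

lemma continuous_on_open_simplex_measurable:
  fixes h :: "(nat \<Rightarrow> real) \<Rightarrow> complex"
  assumes "continuous_on (open_simplex d) h"
  shows "set_borel_measurable (simplex_measure d) (open_simplex d) h"
proof -
  have "(\<lambda>t. t) \<in> measurable (restrict_space (simplex_measure d) (open_simplex d)) (restrict_space borel (open_simplex d))"
    using ident_measurable_simplex by (rule measurable_restrict_space3) auto
  from measurable_compose[OF this borel_measurable_continuous_on_restrict[OF assms]]
  show ?thesis
    using open_simplex_sets[of d] by (simp add: set_borel_measurable_def borel_measurable_restrict_space_iff)
qed

lemma set_integrable_bounded_mult:
  fixes h j :: "(nat \<Rightarrow> real) \<Rightarrow> complex"
  assumes h: "continuous_on (open_simplex d) h" "\<And>t. t \<in> open_simplex d \<Longrightarrow> cmod (h t) \<le> B"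
    and j: "set_integrable (simplex_measure d) (open_simplex d) j"
  shows "set_integrable (simplex_measure d) (open_simplex d) (\<lambda>t. h t * j t)"
proof -
  let ?i = "indicat_real (open_simplex d)"
  have j': "integrable (simplex_measure d) (\<lambda>t. ?i t *\<^sub>R j t)" using j by (simp add: set_integrable_def)
  have "(\<lambda>t. (?i t *\<^sub>R h t) * (?i t *\<^sub>R j t)) \<in> borel_measurable (simplex_measure d)"
    using continuous_on_open_simplex_measurable[OF h(1)] borel_measurable_integrable[OF j']
    by (intro borel_measurable_times) (auto simp: set_borel_measurable_def)
  moreover have eq: "(\<lambda>t. (?i t *\<^sub>R h t) * (?i t *\<^sub>R j t)) = (\<lambda>t. ?i t *\<^sub>R (h t * j t))"
    by (auto simp: indicator_def)
  ultimately have meas: "(\<lambda>t. ?i t *\<^sub>R (h t * j t)) \<in> borel_measurable (simplex_measure d)" by simp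
  have int: "integrable (simplex_measure d) (\<lambda>t. of_real B * (?i t *\<^sub>R j t))"
    using j' by (rule integrable_mult_right)
  have "norm (?i t *\<^sub>R (h t * j t)) \<le> norm (of_real B * (?i t *\<^sub>R j t))" for t
  proof (cases "t \<in> open_simplex d")
    case True
    then show ?thesis using h(2)[OF True] by (auto simp: norm_mult intro!: mult_right_mono)
  qed auto
  then show ?thesis
    unfolding set_integrable_def by (intro Bochner_Integration.integrable_bound[OF int meas] AE_I2)
qed

lemma emeasure_box_pos:
  fixes X :: "nat \<Rightarrow> real set"
  assumes "\<And>i. open (X i)" "\<And>i. i \<in> {1..d} \<Longrightarrow> X i \<noteq> {}"
  shows "emeasure (simplex_measure d) (PiE {1..d} X) > 0"
proof -
  interpret product_sigma_finite "\<lambda>_ :: nat. lborel :: real measure" ..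
  have "emeasure (simplex_measure d) (PiE {1..d} X) = (\<Prod>i\<in>{1..d}. emeasure lborel (X i))"
    using assms(1) by (intro emeasure_PiM) auto
  moreover have "emeasure lborel (X i) \<noteq> 0" if i: "i \<in> {1..d}" for i
  proof -
    obtain x e where e: "e > 0" "ball x e \<subseteq> X i"
      using assms(1)[of i] assms(2)[OF i] by (meson all_not_in_conv open_contains_ball)
    have "ennreal (2 * e) = emeasure lborel (ball x e)"
      using e(1) by (simp add: ball_eq_greaterThanLessThan)
    also have "\<dots> \<le> emeasure lborel (X i)"
      using e(2) assms(1)[of i] by (intro emeasure_mono) auto
    finally show ?thesis using e(1) by auto
  qed
  ultimately show ?thesis by (simp add: zero_less_iff_neq_zero)
qed

text \<open>A continuous density that is positive at \<open>t0\<close> is nonzero on a box around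
  it, and boxes have positive measure. The open simplex is not open among the functions
  \<open>nat => real\<close>, since its points are fixed outside \<open>{1..d}\<close>; hence the
  open set \<open>O'\<close>, which drops this condition.\<close>

lemma set_integral_zero_imp_zero:
  fixes h :: "(nat \<Rightarrow> real) \<Rightarrow> real"
  assumes cont: "continuous_on (open_simplex d) h"
    and int: "set_integrable (simplex_measure d) (open_simplex d) h"
    and nonneg: "\<And>t. t \<in> open_simplex d \<Longrightarrow> 0 \<le> h t"
    and zero: "(LINT t:open_simplex d|simplex_measure d. h t) = 0"
    and t0: "t0 \<in> open_simplex d"
  shows "h t0 = 0"
proof (rule ccontr)
  assume ne: "h t0 \<noteq> 0"
  have AE_zero: "AE t in simplex_measure d. indicat_real (open_simplex d) t *\<^sub>R h t = 0"
    using int nonneg zero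
    by (subst integral_nonneg_eq_0_iff_AE[symmetric])
      (auto simp: set_integrable_def set_lebesgue_integral_def indicator_def)
  obtain U where U: "open U" "U \<inter> open_simplex d = h -` (- {0}) \<inter> open_simplex d"
    using cont unfolding continuous_on_open_invariant by (metis open_Compl closed_singleton)
  define O' where "O' = U \<inter> ({t. (\<Sum>j\<in>{1..d}. t j) < 1} \<inter> (\<Inter>j\<in>{1..d}. {t. 0 < t j}))"
  have "open O'"
    unfolding O'_def using U(1)
    by (intro open_Int open_INT ballI open_Collect_less) (auto intro!: continuous_intros)
  then have openin_O: "openin (product_topology (\<lambda>_. euclidean) UNIV) O'" by (simp add: open_fun_def)
  have t0_O: "t0 \<in> O'" using t0 ne U(2) by (auto simp: O'_def open_simplex_def)
  from product_topology_open_contains_basis[OF openin_O t0_O] obtain X where X: "t0 \<in> PiE UNIV X" "\<And>i. openin euclidean (X i)" "PiE UNIV X \<subseteq> O'"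
    by blast
  have box: "h t \<noteq> 0 \<and> t \<in> open_simplex d" if t: "t \<in> PiE {1..d} X" for t
  proof -
    \<comment> \<open>Outside \<open>{1..d}\<close> both points take the value
      \<open>undefined\<close>, so the finite-dimensional box lies in the full one.\<close>
    have "t i \<in> X i" for i
    proof (cases "i \<in> {1..d}")
      case False
      then have "t i = t0 i" using t t0 by (auto simp: open_simplex_def PiE_def extensional_def)
      then show ?thesis using X(1) by auto
    qed (use t in auto)
    then have "t \<in> O'" using X(3) by auto
    then show ?thesis using U(2) t by (auto simp: O'_def open_simplex_def PiE_def)
  qed
  have sets: "PiE {1..d} X \<in> sets (simplex_measure d)"
    using X(2) by (intro sets_PiM_I_finite) auto
  have "AE t in simplex_measure d. t \<notin> PiE {1..d} X"
    using AE_zero by eventually_elim (use box in \<open>auto simp: indicator_def\<close>)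
  then have "emeasure (simplex_measure d) (PiE {1..d} X) = 0"
    using AE_iff_null_sets[OF sets] by auto
  moreover have "X i \<noteq> {}" for i using X(1) by auto
  ultimately show False using emeasure_box_pos[of X d] X(2) by simp
qed

section \<open>Regular functions and forms along a chain\<close>

lemma continuous_on_peval:
  assumes p: "p \<in> polys_over K n" and h: "\<And>k. k < n \<Longrightarrow> continuous_on A (\<lambda>t. h t k)"
  shows "continuous_on A (\<lambda>t. peval p (h t))"
  unfolding peval_def
proof (intro continuous_intros h)
  fix m i assume "m \<in> Poly_Mapping.keys p" "i \<in> Poly_Mapping.keys m"
  then show "i < n" using p by (auto simp: polys_over_def)
qed

lemma peval_bounded:
  assumes p: "p \<in> polys_over K n" and S: "\<And>k. k < n \<Longrightarrow> \<exists>B. \<forall>x\<in>S. cmod (x k) \<le> B"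
  shows "\<exists>B. \<forall>x\<in>S. cmod (peval p x) \<le> B"
proof -
  obtain B where B: "\<And>k x. k < n \<Longrightarrow> x \<in> S \<Longrightarrow> cmod (x k) \<le> B k"
    using S by metis
  have "cmod (peval p x) \<le> (\<Sum>m\<in>Poly_Mapping.keys p. cmod (poly_mapping.lookup p m) *
      (\<Prod>i\<in>Poly_Mapping.keys m. B i ^ poly_mapping.lookup m i))" if x: "x \<in> S" for x
    unfolding peval_def
  proof (rule sum_norm_le)
    fix m assume m: "m \<in> Poly_Mapping.keys p"
    have "i < n" if "i \<in> Poly_Mapping.keys m" for i using m that p by (auto simp: polys_over_def)
    then have "(\<Prod>i\<in>Poly_Mapping.keys m. cmod (x i ^ poly_mapping.lookup m i)) \<le>
        (\<Prod>i\<in>Poly_Mapping.keys m. B i ^ poly_mapping.lookup m i)"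
      using B x by (intro prod_mono) (auto simp: norm_power intro!: power_mono)
    then show "cmod (poly_mapping.lookup p m * (\<Prod>i\<in>Poly_Mapping.keys m. x i ^ poly_mapping.lookup m i)) \<le>
        cmod (poly_mapping.lookup p m) * (\<Prod>i\<in>Poly_Mapping.keys m. B i ^ poly_mapping.lookup m i)"
      by (simp add: norm_mult prod_norm[symmetric] mult_left_mono)
  qed
  then show ?thesis by blast
qed

lemma form_density_scale:
  "form_density n d \<sigma> (scale_form u w) s t = u (s (simplex_pt d t)) * form_density n d \<sigma> w s t"
  by (simp add: form_density_def pullback_def scale_form_def sum_distrib_left algebra_simps)

lemma nonneg_on_chain_scale:
  assumes "nonneg_on_chain n d \<sigma> w" "\<And>x. x \<in> chain_support d \<sigma> \<Longrightarrow> u x \<in> \<real>\<^sub>\<ge>\<^sub>0"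
  shows "nonneg_on_chain n d \<sigma> (scale_form u w)"
  unfolding nonneg_on_chain_def form_density_scale
proof (intro ballI nonneg_Reals_mult_I)
  fix s t assume *: "s \<in> Poly_Mapping.keys \<sigma>" "t \<in> open_simplex d"
  then show "u (s (simplex_pt d t)) \<in> \<real>\<^sub>\<ge>\<^sub>0"
    using simplex_pt_in_standard_simplex[of t d] by (intro assms) (auto simp: chain_support_def)
  show "form_density n d \<sigma> w s t \<in> \<real>\<^sub>\<ge>\<^sub>0"
    using assms(1) * by (auto simp: nonneg_on_chain_def)
qed

lemma chain_mass_nonneg: "0 \<le> chain_mass n d \<sigma> w"
  unfolding chain_mass_def set_lebesgue_integral_def by (intro sum_nonneg integral_nonneg) auto

lemma chain_integral_nonneg:
  assumes "nonneg_on_chain n d \<sigma> w" "\<And>x. x \<in> chain_support d \<sigma> \<Longrightarrow> u x \<in> \<real>\<^sub>\<ge>\<^sub>0"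
  shows "chain_integral n d \<sigma> (scale_form u w) \<in> \<real>\<^sub>\<ge>\<^sub>0"
  using chain_integral_eq_mass[OF nonneg_on_chain_scale[OF assms]] by (simp add: chain_mass_nonneg)

locale integration_chain =
  fixes n d :: nat and X Y :: "(nat \<Rightarrow> complex) set" and \<sigma> :: "(nat \<Rightarrow> complex) chain" and w :: diff_form
  assumes X: "X \<subseteq> affine_space n"
    and w: "w \<in> diff_forms n X d"
    and \<sigma>: "relative_chain n d X Y \<sigma>"
begin

lemma simplex_continuous_map:
  "s \<in> Poly_Mapping.keys \<sigma> \<Longrightarrow>
    continuous_map (subtopology (powertop_real UNIV) (standard_simplex d)) (complex_points n X) s"
  using \<sigma> by (auto simp: relative_chain_def singular_relcycle_def singular_chain_def singular_simplex_def)

lemma simplex_in: "s \<in> Poly_Mapping.keys \<sigma> \<Longrightarrow> p \<in> standard_simplex d \<Longrightarrow> s p \<in> X"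
  using continuous_map_image_subset_topspace[OF simplex_continuous_map[of s]]
  by (auto simp: complex_points_def)

lemma support_subset: "chain_support d \<sigma> \<subseteq> X"
  using simplex_in by (auto simp: chain_support_def)

lemma locus_subset: "nonvanishing_locus n d \<sigma> w \<subseteq> X"
  using simplex_in simplex_pt_in_standard_simplex by (auto simp: nonvanishing_locus_def)

lemma simplex_coord_continuous:
  assumes "s \<in> Poly_Mapping.keys \<sigma>" "k < n"
  shows "continuous_on (standard_simplex d) (\<lambda>p. s p k)"
proof -
  have "continuous_map (complex_points n X) euclidean (\<lambda>x. x k)"
    unfolding complex_points_def using assms(2)
    by (intro continuous_map_from_subtopology continuous_map_product_projection) auto
  from continuous_map_compose[OF simplex_continuous_map[OF assms(1)] this]
  show ?thesis
    unfolding euclidean_product_topology continuous_map_iff_continuous by (simp add: o_def)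
qed

lemma support_bounded:
  assumes "k < n" shows "\<exists>B. \<forall>x\<in>chain_support d \<sigma>. cmod (x k) \<le> B"
proof -
  have "compact (standard_simplex d)"
    using compactin_standard_simplex[of d] by (simp add: euclidean_product_topology)
  then have "\<exists>B. \<forall>p\<in>standard_simplex d. cmod (s p k) \<le> B" if "s \<in> Poly_Mapping.keys \<sigma>" for s
    using compact_continuous_image[OF simplex_coord_continuous[OF that assms]]
    by (auto dest!: compact_imp_bounded simp: bounded_iff)
  then obtain B where B: "\<And>s p. s \<in> Poly_Mapping.keys \<sigma> \<Longrightarrow> p \<in> standard_simplex d \<Longrightarrow> cmod (s p k) \<le> B s"
    by metis
  have "cmod (x k) \<le> (\<Sum>s\<in>Poly_Mapping.keys \<sigma>. \<bar>B s\<bar>)" if "x \<in> chain_support d \<sigma>" for x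
  proof -
    from that obtain s p where s: "s \<in> Poly_Mapping.keys \<sigma>" "p \<in> standard_simplex d" "x = s p"
      by (auto simp: chain_support_def)
    then have "cmod (x k) \<le> \<bar>B s\<bar>" using B[of s p] by auto
    also have "\<dots> \<le> (\<Sum>s\<in>Poly_Mapping.keys \<sigma>. \<bar>B s\<bar>)"
      using s(1) by (intro member_le_sum) auto
    finally show ?thesis .
  qed
  then show ?thesis by blast
qed

lemma pulled_back_coord_continuous:
  assumes "s \<in> Poly_Mapping.keys \<sigma>" "k < n"
  shows "continuous_on (open_simplex d) (\<lambda>t. s (simplex_pt d t) k)"
  using simplex_pt_in_standard_simplex
  by (intro continuous_on_compose2[OF simplex_coord_continuous[OF assms] continuous_simplex_pt]) auto

lemma pulled_back_continuous:
  assumes s: "s \<in> Poly_Mapping.keys \<sigma>" and p: "p \<in> polys_over K n"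
    and u: "\<And>x. x \<in> X \<Longrightarrow> u x = peval p x"
  shows "continuous_on (open_simplex d) (\<lambda>t. u (s (simplex_pt d t)))"
proof -
  have "continuous_on (open_simplex d) (\<lambda>t. peval p (s (simplex_pt d t)))"
    using pulled_back_coord_continuous[OF s] by (intro continuous_on_peval[OF p])
  then show ?thesis
    by (rule continuous_on_eq) (use u simplex_in[OF s] simplex_pt_in_standard_simplex in auto)
qed

lemma support_peval_bounded:
  assumes p: "p \<in> polys_over K n" and u: "\<And>x. x \<in> X \<Longrightarrow> u x = peval p x"
  obtains B where "\<And>x. x \<in> chain_support d \<sigma> \<Longrightarrow> cmod (u x) \<le> B"
  using peval_bounded[OF p support_bounded] u support_subset that by (metis subsetD)

lemma set_integrable_pulled_back_mult:
  assumes s: "s \<in> Poly_Mapping.keys \<sigma>" and p: "p \<in> polys_over K n"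
    and u: "\<And>x. x \<in> X \<Longrightarrow> u x = peval p x"
    and j: "set_integrable (simplex_measure d) (open_simplex d) j"
  shows "set_integrable (simplex_measure d) (open_simplex d) (\<lambda>t. u (s (simplex_pt d t)) * j t)"
proof -
  obtain B where B: "\<And>x. x \<in> chain_support d \<sigma> \<Longrightarrow> cmod (u x) \<le> B"
    using support_peval_bounded[OF p u] by blast
  show ?thesis
    using s simplex_pt_in_standard_simplex
    by (intro set_integrable_bounded_mult[OF pulled_back_continuous[OF s p u] _ j, where B = B] B)
      (auto simp: chain_support_def)
qed

lemma coefficient_poly:
  assumes "I \<in> index_sets n d"
  obtains p where "p \<in> polys_over \<rat> n" "\<And>x. x \<in> X \<Longrightarrow> w I x = peval p x"
proof -
  have "w I \<in> coord_ring n X" using w assms by (auto simp: diff_forms_def)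
  then obtain p where p: "p \<in> polys_over \<rat> n" "w I = restrict (peval p) X" by (auto simp: coord_ring_def)
  show ?thesis by (rule that[OF p(1)]) (simp add: p(2))
qed

text \<open>Finite volume makes the minors integrable. The coefficients of the form are polynomials
  on a compact support, hence bounded, and multiplication by them preserves integrability.\<close>

lemma form_density_integrable:
  assumes s: "s \<in> Poly_Mapping.keys \<sigma>"
  shows "set_integrable (simplex_measure d) (open_simplex d) (form_density n d \<sigma> w s)"
proof -
  have "set_integrable (simplex_measure d) (open_simplex d) (\<lambda>t. w I (s (simplex_pt d t)) * jacobian_minor d s I t)"
    if I: "I \<in> index_sets n d" for I
  proof -
    obtain p where "p \<in> polys_over \<rat> n" "\<And>x. x \<in> X \<Longrightarrow> w I x = peval p x"
      using coefficient_poly[OF I] by blast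
    moreover have "set_integrable (simplex_measure d) (open_simplex d) (jacobian_minor d s I)"
      using \<sigma> s I by (auto simp: relative_chain_def integration_simplex_def)
    ultimately show ?thesis by (intro set_integrable_pulled_back_mult[OF s])
  qed
  then have "set_integrable (simplex_measure d) (open_simplex d) (pullback n d w s)"
    unfolding set_integrable_def pullback_def scaleR_sum_right
    by (rule Bochner_Integration.integrable_sum)
  then show ?thesis
    unfolding form_density_def by (intro set_integrable_mult_right)
qed

lemma scaled_density_integrable:
  assumes s: "s \<in> Poly_Mapping.keys \<sigma>" and p: "p \<in> polys_over K n"
    and u: "\<And>x. x \<in> X \<Longrightarrow> u x = peval p x"
  shows "set_integrable (simplex_measure d) (open_simplex d) (form_density n d \<sigma> (scale_form u w) s)"
proof -
  have "form_density n d \<sigma> (scale_form u w) s = (\<lambda>t. u (s (simplex_pt d t)) * form_density n d \<sigma> w s t)"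
    by (rule ext) (rule form_density_scale)
  then show ?thesis
    using set_integrable_pulled_back_mult[OF s p u form_density_integrable[OF s]] by (simp only:)
qed

lemma jacobian_minor_continuous:
  assumes s: "s \<in> Poly_Mapping.keys \<sigma>" and I: "I \<in> index_sets n d"
  shows "continuous_on (open_simplex d) (jacobian_minor d s I)"
proof -
  have eq: "jacobian_minor d s I = (\<lambda>t. \<Sum>\<pi> | \<pi> permutes {0..<d}. signof \<pi> *
      (\<Prod>i\<in>{0..<d}. simplex_partial d s (sorted_list_of_set I ! i) (Suc (\<pi> i)) t))"
    unfolding jacobian_minor_def
    by (rule ext, subst det_def') (auto intro!: sum.cong prod.cong simp: permutes_in_image)
  show ?thesis
    unfolding eq
  proof (intro continuous_intros)
    fix \<pi> i assume "\<pi> \<in> {\<pi>. \<pi> permutes {0..<d}}" "i \<in> {0..<d}"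
    then have "\<pi> i \<in> {0..<d}" by (metis mem_Collect_eq permutes_in_image)
    then have "Suc (\<pi> i) \<in> {1..d}" by auto
    moreover have "finite I" "I \<subseteq> {..<n}" "card I = d"
      using I by (auto simp: index_sets_def intro: finite_subset)
    then have "sorted_list_of_set I ! i \<in> I"
      using \<open>i \<in> {0..<d}\<close> by (metis atLeastLessThan_iff length_sorted_list_of_set nth_mem set_sorted_list_of_set)
    then have "sorted_list_of_set I ! i < n" using \<open>I \<subseteq> {..<n}\<close> by auto
    ultimately show "continuous_on (open_simplex d) (simplex_partial d s (sorted_list_of_set I ! i) (Suc (\<pi> i)))"
      using \<sigma> s by (auto simp: relative_chain_def integration_simplex_def)
  qed
qed

lemma form_density_continuous:
  assumes s: "s \<in> Poly_Mapping.keys \<sigma>"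
  shows "continuous_on (open_simplex d) (form_density n d \<sigma> w s)"
  unfolding form_density_def pullback_def
proof (intro continuous_intros jacobian_minor_continuous[OF s])
  fix I assume I: "I \<in> index_sets n d"
  obtain p where "p \<in> polys_over \<rat> n" "\<And>x. x \<in> X \<Longrightarrow> w I x = peval p x"
    using coefficient_poly[OF I] by blast
  then show "continuous_on (open_simplex d) (\<lambda>t. w I (s (simplex_pt d t)))"
    by (rule pulled_back_continuous[OF s])
qed

text \<open>A non-integrable function has integral 0 by convention, so additivity requires each term
  to be integrable; this is why the \<open>u a\<close> are assumed polynomial on
  \<open>X\<close>.\<close>

lemma chain_integral_sum:
  assumes A: "finite A"
    and p: "\<And>a. a \<in> A \<Longrightarrow> p a \<in> polys_over K n"
    and u: "\<And>a x. a \<in> A \<Longrightarrow> x \<in> X \<Longrightarrow> u a x = peval (p a) x"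
  shows "chain_integral n d \<sigma> (scale_form (\<lambda>x. \<Sum>a\<in>A. c a * u a x) w) =
    (\<Sum>a\<in>A. c a * chain_integral n d \<sigma> (scale_form (u a) w))"
proof -
  let ?D = "\<lambda>u s t. indicat_real (open_simplex d) t *\<^sub>R form_density n d \<sigma> (scale_form u w) s t"
  have "(\<integral>t. ?D (\<lambda>x. \<Sum>a\<in>A. c a * u a x) s t \<partial>simplex_measure d) = (\<Sum>a\<in>A. c a * (\<integral>t. ?D (u a) s t \<partial>simplex_measure d))"
    if s: "s \<in> Poly_Mapping.keys \<sigma>" for s
  proof -
    have int: "integrable (simplex_measure d) (?D (u a) s)" if "a \<in> A" for a
      using scaled_density_integrable[OF s p[OF that] u[OF that]] by (simp add: set_integrable_def)
    have "?D (\<lambda>x. \<Sum>a\<in>A. c a * u a x) s = (\<lambda>t. \<Sum>a\<in>A. c a * ?D (u a) s t)"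
      by (rule ext) (simp add: form_density_scale sum_distrib_right scaleR_sum_right mult.assoc)
    then have "(\<integral>t. ?D (\<lambda>x. \<Sum>a\<in>A. c a * u a x) s t \<partial>simplex_measure d) =
        (\<Sum>a\<in>A. \<integral>t. c a * ?D (u a) s t \<partial>simplex_measure d)"
      by (simp only:) (intro Bochner_Integration.integral_sum integrable_mult_right int)
    then show ?thesis by (simp only: integral_mult_right_zero)
  qed
  then show ?thesis
    unfolding chain_integral_def set_lebesgue_integral_def
    by (simp add: sum_distrib_left sum.swap[of _ A])
qed

text \<open>Here \<open>u\<close> is arbitrary, as the induction rule demands. If the density is not
  integrable, its integral is 0 by convention, and the non-negative majorant keeps the estimate
  true.\<close>

lemma cmod_chain_integral_le:
  assumes B: "0 \<le> B" "\<And>x. x \<in> chain_support d \<sigma> \<Longrightarrow> cmod (u x) \<le> B"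
  shows "cmod (chain_integral n d \<sigma> (scale_form u w)) \<le> chain_mass n d \<sigma> w * B"
proof -
  let ?i = "indicat_real (open_simplex d)"
  have "cmod (\<integral>t. ?i t *\<^sub>R form_density n d \<sigma> (scale_form u w) s t \<partial>simplex_measure d) \<le>
      (\<integral>t. ?i t *\<^sub>R cmod (form_density n d \<sigma> w s t) \<partial>simplex_measure d) * B"
    if s: "s \<in> Poly_Mapping.keys \<sigma>" for s
  proof -
    have "cmod (\<integral>t. ?i t *\<^sub>R form_density n d \<sigma> (scale_form u w) s t \<partial>simplex_measure d) \<le>
        (\<integral>t. cmod (?i t *\<^sub>R form_density n d \<sigma> (scale_form u w) s t) \<partial>simplex_measure d)"
      by (rule integral_norm_bound)
    also have "\<dots> \<le> (\<integral>t. (?i t *\<^sub>R cmod (form_density n d \<sigma> w s t)) * B \<partial>simplex_measure d)"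
    proof (rule integral_mono')
      have "integrable (simplex_measure d) (\<lambda>t. cmod (?i t *\<^sub>R form_density n d \<sigma> w s t))"
        using form_density_integrable[OF s] by (intro integrable_norm) (simp add: set_integrable_def)
      moreover have "(\<lambda>t. cmod (?i t *\<^sub>R form_density n d \<sigma> w s t)) =
          (\<lambda>t. ?i t *\<^sub>R cmod (form_density n d \<sigma> w s t))"
        by (auto simp: indicator_def)
      ultimately have "integrable (simplex_measure d) (\<lambda>t. ?i t *\<^sub>R cmod (form_density n d \<sigma> w s t))"
        by (simp only:)
      then show "integrable (simplex_measure d) (\<lambda>t. (?i t *\<^sub>R cmod (form_density n d \<sigma> w s t)) * B)"
        by (rule integrable_mult_left)
      fix t
      show "0 \<le> (?i t *\<^sub>R cmod (form_density n d \<sigma> w s t)) * B" using B(1) by auto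
      show "cmod (?i t *\<^sub>R form_density n d \<sigma> (scale_form u w) s t) \<le> (?i t *\<^sub>R cmod (form_density n d \<sigma> w s t)) * B"
      proof (cases "t \<in> open_simplex d")
        case True
        then have "cmod (u (s (simplex_pt d t))) \<le> B"
          using s simplex_pt_in_standard_simplex[OF True] by (intro B) (auto simp: chain_support_def)
        then show ?thesis using True by (simp add: form_density_scale norm_mult mult.commute mult_right_mono)
      qed auto
    qed
    finally show ?thesis by simp
  qed
  then show ?thesis
    unfolding chain_integral_def chain_mass_def set_lebesgue_integral_def sum_distrib_right
    by (rule sum_norm_le)
qed

text \<open>The integral is a mass, a sum of non-negative contributions of the simplices, so each of
  them is 0. By continuity the density \<open>u\<close> times that of \<open>w\<close> vanishes
  pointwise, and on the locus the second factor is nonzero.\<close>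

lemma vanishing_on_locus:
  assumes nonneg: "nonneg_on_chain n d \<sigma> w"
    and p: "p \<in> polys_over K n" and u: "\<And>x. x \<in> X \<Longrightarrow> u x = peval p x"
    and pos: "\<And>x. x \<in> chain_support d \<sigma> \<Longrightarrow> u x \<in> \<real>\<^sub>\<ge>\<^sub>0"
    and zero: "chain_integral n d \<sigma> (scale_form u w) = 0"
    and x: "x \<in> nonvanishing_locus n d \<sigma> w"
  shows "u x = 0"
proof -
  from x obtain s t where s: "s \<in> Poly_Mapping.keys \<sigma>" and t: "t \<in> open_simplex d" "x = s (simplex_pt d t)"
    "form_density n d \<sigma> w s t \<noteq> 0" by (auto simp: nonvanishing_locus_def)
  let ?h = "\<lambda>s t. cmod (form_density n d \<sigma> (scale_form u w) s t)"
  have "chain_mass n d \<sigma> (scale_form u w) = 0"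
    using chain_integral_eq_mass[OF nonneg_on_chain_scale[OF nonneg pos]] zero by simp
  then have "(LINT t:open_simplex d|simplex_measure d. ?h s t) = 0"
    unfolding chain_mass_def set_lebesgue_integral_def
    by (subst (asm) sum_nonneg_eq_0_iff) (use s in \<open>auto intro!: integral_nonneg\<close>)
  moreover have "set_integrable (simplex_measure d) (open_simplex d) (?h s)"
    using scaled_density_integrable[OF s p u] by (rule set_integrable_norm)
  moreover have "continuous_on (open_simplex d) (?h s)"
    unfolding form_density_scale
    by (intro continuous_intros pulled_back_continuous[OF s p u] form_density_continuous[OF s])
  ultimately have "?h s t = 0"
    using t(1) by (intro set_integral_zero_imp_zero[of d "?h s"]) auto
  then show ?thesis using t by (simp add: form_density_scale)
qed

end

section \<open>The determinant of the period matrix\<close>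

text \<open>The terms \<open>m ^ N / N!\<close> of the exponential series tend to 0. This is the
  origin of the constant, and why it depends on the mass alone.\<close>

lemma power_less_fact: "\<exists>C :: nat. \<forall>N>C. (m :: real) ^ N < fact N"
proof -
  have "(\<lambda>n. inverse (fact n) * m ^ n) \<longlonglongrightarrow> 0"
    by (rule summable_LIMSEQ_zero[OF summable_exp])
  then have "\<forall>\<^sub>F n in sequentially. inverse (fact n) * m ^ n < 1"
    by (rule order_tendstoD) simp
  then obtain C where "\<And>n. n \<ge> C \<Longrightarrow> inverse (fact n) * m ^ n < 1"
    by (auto simp: eventually_sequentially)
  then have "m ^ n < fact n" if "n > C" for n
    using that by (fastforce simp: field_simps)
  then show ?thesis by blast
qed

lemma det_Reals:
  assumes "\<And>i j. i < N \<Longrightarrow> j < N \<Longrightarrow> a i j \<in> \<real>"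
  shows "Determinant.det (Matrix.mat N N (\<lambda>(i, j). a i j)) \<in> (\<real> :: complex set)"
proof (subst det_def')
  show "(\<Sum>\<pi> | \<pi> permutes {0..<N}. signof \<pi> * (\<Prod>i = 0..<N. Matrix.mat N N (\<lambda>(i, j). a i j) $$ (i, \<pi> i))) \<in> \<real>"
  proof (intro sum_in_Reals Reals_mult prod_in_Reals)
    fix \<pi> i assume \<pi>: "\<pi> \<in> {\<pi>. \<pi> permutes {0..<N}}" "i \<in> {0..<N}"
    then have "\<pi> i \<in> {0..<N}" by (metis mem_Collect_eq permutes_in_image)
    then show "Matrix.mat N N (\<lambda>(i, j). a i j) $$ (i, \<pi> i) \<in> \<real>" using assms \<pi> by simp
  qed simp
qed auto

context integration_chain
begin

context
  fixes N :: nat and g :: "nat \<Rightarrow> (nat \<Rightarrow> complex) \<Rightarrow> complex"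
  assumes g: "\<And>i. i < N \<Longrightarrow> \<exists>p\<in>polys_over UNIV n. \<forall>x\<in>X. g i x = peval p x"
begin

lemma product_poly:
  assumes "i < N" "j < N"
  shows "\<exists>p\<in>polys_over UNIV n. \<forall>x\<in>X. g i x * g j x = peval p x"
proof -
  from g[OF assms(1)] g[OF assms(2)] obtain p q where
    p: "p \<in> polys_over UNIV n" "\<forall>x\<in>X. g i x = peval p x" and q: "q \<in> polys_over UNIV n" "\<forall>x\<in>X. g j x = peval q x"
    by blast
  have "poly_fun UNIV n (\<lambda>x. peval p x * peval q x)"
    using p q by (intro poly_fun_mult complex_subring_UNIV poly_fun_peval)
  then obtain r where r: "r \<in> polys_over UNIV n" "(\<lambda>x. peval p x * peval q x) = peval r"
    by (auto simp: poly_fun_def)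
  then show ?thesis using p q by (intro bexI[of _ r]) (auto simp: fun_eq_iff)
qed

lemma chain_integral_products:
  assumes "finite A" "\<And>a. a \<in> A \<Longrightarrow> i a < N \<and> j a < N"
  shows "chain_integral n d \<sigma> (scale_form (\<lambda>x. \<Sum>a\<in>A. c a * (g (i a) x * g (j a) x)) w) =
    (\<Sum>a\<in>A. c a * chain_integral n d \<sigma> (scale_form (\<lambda>x. g (i a) x * g (j a) x) w))"
proof -
  have "\<forall>a\<in>A. \<exists>p. p \<in> polys_over UNIV n \<and> (\<forall>x\<in>X. g (i a) x * g (j a) x = peval p x)"
    using product_poly assms(2) by blast
  from bchoice[OF this] obtain p where
    "\<forall>a\<in>A. p a \<in> polys_over UNIV n \<and> (\<forall>x\<in>X. g (i a) x * g (j a) x = peval (p a) x)" by blast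
  then show ?thesis by (intro chain_integral_sum[OF assms(1)]) auto
qed

text \<open>The supremum in \<open>det_sup\<close> is taken in the reals and is an upper bound only
  for a set that is bounded above.\<close>

lemma det_bdd_above:
  "bdd_above ((\<lambda>z. cmod (Determinant.det (Matrix.mat N N (\<lambda>(i, j). g j (z i))))) ` ({..<N} \<rightarrow>\<^sub>E chain_support d \<sigma>))"
proof -
  have "\<exists>B. \<forall>x\<in>chain_support d \<sigma>. cmod (g j x) \<le> B" if "j < N" for j
    using g[OF that] support_peval_bounded[of _ UNIV "g j"] by metis
  then obtain B where B: "\<And>j x. j < N \<Longrightarrow> x \<in> chain_support d \<sigma> \<Longrightarrow> cmod (g j x) \<le> B j"
    by metis
  have "cmod (Determinant.det (Matrix.mat N N (\<lambda>(i, j). g j (z i)))) \<le>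
      (\<Sum>\<pi> | \<pi> permutes {0..<N}. \<Prod>i\<in>{0..<N}. B (\<pi> i))"
    if z: "z \<in> {..<N} \<rightarrow>\<^sub>E chain_support d \<sigma>" for z
    unfolding det_def'[OF mat_carrier]
  proof (rule sum_norm_le)
    fix \<pi> assume "\<pi> \<in> {\<pi>. \<pi> permutes {0..<N}}"
    then have *: "\<pi> i < N" if "i < N" for i
      using that permutes_in_image[of \<pi> "{0..<N}" i] by simp
    have "cmod (signof \<pi> * (\<Prod>i = 0..<N. Matrix.mat N N (\<lambda>(i, j). g j (z i)) $$ (i, \<pi> i))) =
        (\<Prod>i = 0..<N. cmod (g (\<pi> i) (z i)))"
      using * by (auto simp: norm_mult sign_def prod_norm[symmetric] intro!: prod.cong)
    also have "\<dots> \<le> (\<Prod>i\<in>{0..<N}. B (\<pi> i))"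
      using B * z by (intro prod_mono) auto
    finally show "cmod (signof \<pi> * (\<Prod>i = 0..<N. Matrix.mat N N (\<lambda>(i, j). g j (z i)) $$ (i, \<pi> i))) \<le>
        (\<Prod>i\<in>{0..<N}. B (\<pi> i))" .
  qed
  then show ?thesis by (intro bdd_aboveI2)
qed

lemma fact_det_period_matrix_le:
  "fact N * cmod (Determinant.det (period_matrix n d \<sigma> w N g)) \<le>
    chain_mass n d \<sigma> w ^ N * (det_sup N g (chain_support d \<sigma>))\<^sup>2"
proof -
  let ?T = "det_sup N g (chain_support d \<sigma>)"
  have "cmod (fact N * Determinant.det (Matrix.mat N N (\<lambda>(i, j).
      chain_integral n d \<sigma> (scale_form (\<lambda>x. g i x * g j x) w)))) \<le> chain_mass n d \<sigma> w ^ N * ?T\<^sup>2"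
  proof (rule andreief_induct[where I = "\<lambda>u. chain_integral n d \<sigma> (scale_form u w)" and g = g
        and S = "chain_support d \<sigma>" and P = "\<lambda>k v. cmod v \<le> chain_mass n d \<sigma> w ^ k * ?T\<^sup>2"])
    fix z assume "z \<in> {..<N} \<rightarrow>\<^sub>E chain_support d \<sigma>"
    then have "cmod (Determinant.det (Matrix.mat N N (\<lambda>(i, j). g j (z i)))) \<le> ?T"
      unfolding det_sup_def by (intro cSUP_upper det_bdd_above)
    then show "cmod ((Determinant.det (Matrix.mat N N (\<lambda>(i, j). g j (z i))))\<^sup>2) \<le>
        chain_mass n d \<sigma> w ^ 0 * ?T\<^sup>2"
      by (simp add: norm_power power_mono)
  next
    fix k and u :: "(nat \<Rightarrow> complex) \<Rightarrow> complex"
    assume "\<And>y. y \<in> chain_support d \<sigma> \<Longrightarrow> cmod (u y) \<le> chain_mass n d \<sigma> w ^ k * ?T\<^sup>2"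
    then have "cmod (chain_integral n d \<sigma> (scale_form u w)) \<le> chain_mass n d \<sigma> w * (chain_mass n d \<sigma> w ^ k * ?T\<^sup>2)"
      by (intro cmod_chain_integral_le) (simp_all add: chain_mass_nonneg)
    then show "cmod (chain_integral n d \<sigma> (scale_form u w)) \<le> chain_mass n d \<sigma> w ^ Suc k * ?T\<^sup>2"
      by (simp add: mult.assoc)
  qed (rule chain_integral_products)
  then show ?thesis by (simp add: period_matrix_def norm_mult)
qed

context
  assumes real: "\<And>i x. i < N \<Longrightarrow> x \<in> chain_support d \<sigma> \<Longrightarrow> g i x \<in> \<real>"
    and nonneg: "nonneg_on_chain n d \<sigma> w"
begin

lemma det_period_matrix_nonneg: "Determinant.det (period_matrix n d \<sigma> w N g) \<in> \<real>\<^sub>\<ge>\<^sub>0"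
proof -
  have "fact N * Determinant.det (Matrix.mat N N (\<lambda>(i, j).
      chain_integral n d \<sigma> (scale_form (\<lambda>x. g i x * g j x) w))) \<in> \<real>\<^sub>\<ge>\<^sub>0"
  proof (rule andreief_induct[where I = "\<lambda>u. chain_integral n d \<sigma> (scale_form u w)" and g = g
        and S = "chain_support d \<sigma>" and P = "\<lambda>_ v. v \<in> \<real>\<^sub>\<ge>\<^sub>0"])
    fix z assume z: "z \<in> {..<N} \<rightarrow>\<^sub>E chain_support d \<sigma>"
    have "Determinant.det (Matrix.mat N N (\<lambda>(i, j). g j (z i))) \<in> \<real>"
      using z by (intro det_Reals real) auto
    then show "(Determinant.det (Matrix.mat N N (\<lambda>(i, j). g j (z i))))\<^sup>2 \<in> \<real>\<^sub>\<ge>\<^sub>0"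
      by (auto elim!: Reals_cases simp flip: of_real_power)
  next
    show "chain_integral n d \<sigma> (scale_form u w) \<in> \<real>\<^sub>\<ge>\<^sub>0"
      if "\<And>y. y \<in> chain_support d \<sigma> \<Longrightarrow> u y \<in> \<real>\<^sub>\<ge>\<^sub>0" for u
      by (rule chain_integral_nonneg[OF nonneg that])
  qed (rule chain_integral_products)
  from nonneg_Reals_mult_I[OF iffD2[OF nonneg_Reals_of_real_iff] this, of "1 / fact N"]
  show ?thesis by (simp add: period_matrix_def)
qed

lemma det_period_matrix_zero_relation:
  assumes zero: "Determinant.det (period_matrix n d \<sigma> w N g) = 0"
  shows "\<exists>c. (\<exists>i<N. c i \<noteq> 0) \<and> (\<forall>x\<in>nonvanishing_locus n d \<sigma> w. (\<Sum>i<N. c i * g i x) = 0)"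
proof -
  let ?q = "\<lambda>i j. chain_integral n d \<sigma> (scale_form (\<lambda>x. g i x * g j x) w)"
  have Q: "period_matrix n d \<sigma> w N g \<in> carrier_mat N N" by (simp add: period_matrix_def)
  from zero obtain v where v: "v \<in> carrier_vec N" "v \<noteq> 0\<^sub>v N" "period_matrix n d \<sigma> w N g *\<^sub>v v = 0\<^sub>v N"
    unfolding det_0_iff_vec_prod_zero_field[OF Q] by blast
  define c where "c i = vec_index v i" for i
  have c: "\<exists>i<N. c i \<noteq> 0" using v(1,2) unfolding c_def by (metis eq_vecI carrier_vecD index_zero_vec)
  have row: "(\<Sum>j<N. ?q i j * c j) = 0" if "i < N" for i
  proof -
    have "vec_index (period_matrix n d \<sigma> w N g *\<^sub>v v) i = (\<Sum>j<N. ?q i j * c j)"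
      using that v(1) by (auto simp: period_matrix_def c_def scalar_prod_def lessThan_atLeast0 intro!: sum.cong)
    then show ?thesis using v(3) that by simp
  qed
  define A where "A = {..<N} \<times> {..<N}"
  \<comment> \<open>The integral of \<open>u\<close> is the Hermitian form of \<open>Q\<close> at
    the kernel vector, hence 0. As a combination of products of the \<open>g i\<close>,
    \<open>u\<close> is polynomial on all of \<open>X\<close>; it is identified with a squared
    modulus on the support, where the \<open>g i\<close> are real.\<close>
  define u where "u x = (\<Sum>a\<in>A. (cnj (c (fst a)) * c (snd a)) * (g (fst a) x * g (snd a) x))" for x
  have "chain_integral n d \<sigma> (scale_form u w) = (\<Sum>a\<in>A. (cnj (c (fst a)) * c (snd a)) * ?q (fst a) (snd a))"
    unfolding u_def by (rule chain_integral_products) (auto simp: A_def)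
  also have "\<dots> = (\<Sum>i<N. cnj (c i) * (\<Sum>j<N. ?q i j * c j))"
    unfolding A_def by (simp add: sum.cartesian_product' sum_distrib_left mult_ac)
  also have "\<dots> = 0" using row by simp
  finally have Iu: "chain_integral n d \<sigma> (scale_form u w) = 0" .
  have u_eq: "u x = of_real ((cmod (\<Sum>i<N. c i * g i x))\<^sup>2)" if "x \<in> chain_support d \<sigma>" for x
  proof -
    have "cnj (\<Sum>i<N. c i * g i x) = (\<Sum>i<N. cnj (c i) * g i x)"
      using real that by (auto simp: Reals_cnj_iff intro!: sum.cong)
    then have "(\<Sum>i<N. cnj (c i) * g i x) * (\<Sum>i<N. c i * g i x) = of_real ((cmod (\<Sum>i<N. c i * g i x))\<^sup>2)"
      by (metis complex_norm_square mult.commute)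
    moreover have "u x = (\<Sum>i<N. cnj (c i) * g i x) * (\<Sum>i<N. c i * g i x)"
      unfolding u_def A_def sum_product by (simp add: sum.cartesian_product' mult_ac)
    ultimately show ?thesis by simp
  qed
  have "\<forall>a\<in>A. \<exists>p. p \<in> polys_over UNIV n \<and> (\<forall>x\<in>X. g (fst a) x * g (snd a) x = peval p x)"
    using product_poly unfolding A_def by fastforce
  from bchoice[OF this] obtain p where
    p: "\<And>a. a \<in> A \<Longrightarrow> p a \<in> polys_over UNIV n"
      "\<And>a x. a \<in> A \<Longrightarrow> x \<in> X \<Longrightarrow> g (fst a) x * g (snd a) x = peval (p a) x" by blast
  have "poly_fun UNIV n (\<lambda>x. \<Sum>a\<in>A. (cnj (c (fst a)) * c (snd a)) * peval (p a) x)"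
    by (intro poly_fun_sum poly_fun_mult poly_fun_const complex_subring_UNIV poly_fun_peval p(1) UNIV_I)
  then obtain r where r: "r \<in> polys_over UNIV n"
    "(\<lambda>x. \<Sum>a\<in>A. (cnj (c (fst a)) * c (snd a)) * peval (p a) x) = peval r"
    unfolding poly_fun_def by blast
  have ur: "u x = peval r x" if "x \<in> X" for x
    unfolding u_def r(2)[symmetric] using p(2) that by simp
  have "(\<Sum>i<N. c i * g i x) = 0" if x: "x \<in> nonvanishing_locus n d \<sigma> w" for x
  proof -
    have "u x = 0"
      by (rule vanishing_on_locus[OF nonneg r(1) ur _ Iu x]) (auto simp: u_eq)
    moreover have "x \<in> chain_support d \<sigma>"
      using x simplex_pt_in_standard_simplex by (auto simp: nonvanishing_locus_def chain_support_def)
    ultimately show ?thesis using u_eq[of x] by simp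
  qed
  then show ?thesis using c by blast
qed

end

end

end

lemma affine_variety_subset: "affine_variety n X \<Longrightarrow> X \<subseteq> affine_space n"
  by (auto simp: affine_variety_def)

lemma morphism_map_in_closure:
  assumes "x \<in> X"
  shows "morphism_map r f x \<in> zariski_closure K r (morphism_map r f ` X)"
proof -
  have "morphism_map r f x \<in> affine_space r"
    unfolding morphism_map_def PiE_def by (intro IntI Pi_I UNIV_I restrict_extensional)
  then show ?thesis using assms unfolding zariski_closure_def by blast
qed

lemma int_basis_pulled_back_poly:
  assumes f: "\<forall>k<r. f k \<in> coord_ring n X"
    and V: "V = zariski_closure \<rat> r (morphism_map r f ` X)"
    and M: "M \<subseteq> coord_ring r V" and basis: "is_int_basis M V N \<phi>" and i: "i < N"
  shows "\<exists>p\<in>polys_over \<rat> n. \<forall>x\<in>X. \<phi> i (morphism_map r f x) = peval p x"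
proof -
  have "\<phi> i \<in> coord_ring r V" using M basis i by (auto simp: is_int_basis_def)
  then obtain q where q: "q \<in> polys_over \<rat> r" "\<phi> i = restrict (peval q) V" by (auto simp: coord_ring_def)
  have "\<forall>k\<in>{..<r}. \<exists>p. p \<in> polys_over \<rat> n \<and> f k = restrict (peval p) X"
    using f by (auto simp: coord_ring_def)
  from bchoice[OF this] obtain F where F: "\<And>k. k < r \<Longrightarrow> F k \<in> polys_over \<rat> n"
    "\<And>k. k < r \<Longrightarrow> f k = restrict (peval (F k)) X" by auto
  have "poly_fun \<rat> n (\<lambda>x. peval q (\<lambda>k. peval (F k) x))"
    by (intro poly_fun_compose[OF complex_subring_Rats q(1)] poly_fun_peval F(1))
  then obtain p where p: "p \<in> polys_over \<rat> n" "(\<lambda>x. peval q (\<lambda>k. peval (F k) x)) = peval p"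
    by (auto simp: poly_fun_def)
  have "\<phi> i (morphism_map r f x) = peval p x" if x: "x \<in> X" for x
  proof -
    \<comment> \<open>A regular function on \<open>V\<close> is cut off outside \<open>V\<close>, so
      the polynomial behind it may be used only once the image point is known to lie in
      \<open>V\<close>.\<close>
    have "morphism_map r f x \<in> V"
      unfolding V using x by (rule morphism_map_in_closure)
    then have "\<phi> i (morphism_map r f x) = peval q (morphism_map r f x)" by (simp add: q(2))
    also have "\<dots> = peval q (\<lambda>k. peval (F k) x)"
      by (rule peval_cong[OF q(1)]) (use F(2) x in \<open>simp add: morphism_map_def\<close>)
    finally show ?thesis using p(2) by (simp add: fun_eq_iff)
  qed
  then show ?thesis using p(1) by blast
qed

text \<open>Although \<open>V\<close> is a closure over \<open>\<rat>\<close> only, a relation with complex coefficients on \<open>f(X)\<close>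
  is excluded, because it descends to a rational one.\<close>

lemma int_basis_independent:
  assumes X: "affine_variety n X"
    and f: "\<forall>k<r. f k \<in> coord_ring n X"
    and V: "V = zariski_closure \<rat> r (morphism_map r f ` X)"
    and M: "M \<subseteq> coord_ring r V" and basis: "is_int_basis M V N \<phi>"
    and rel: "\<And>x. x \<in> X \<Longrightarrow> (\<Sum>i<N. c i * \<phi> i (morphism_map r f x)) = 0"
    and i: "i < N"
  shows "c i = 0"
proof (rule ccontr)
  assume c: "c i \<noteq> 0"
  have "\<forall>i\<in>{..<N}. \<exists>p. p \<in> polys_over \<rat> n \<and> (\<forall>x\<in>X. \<phi> i (morphism_map r f x) = peval p x)"
    using int_basis_pulled_back_poly[OF f V M basis] by blast
  from bchoice[OF this] obtain p where p: "\<And>i. i < N \<Longrightarrow> p i \<in> polys_over \<rat> n"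
    "\<And>i x. i < N \<Longrightarrow> x \<in> X \<Longrightarrow> \<phi> i (morphism_map r f x) = peval (p i) x" by auto
  have "(\<Sum>i<N. c i * peval (p i) x) = 0" if "x \<in> X" for x
    using rel[OF that] p(2)[OF _ that] by simp
  from rational_relation[OF X p(1) this i c] obtain b where b: "\<And>i. i < N \<Longrightarrow> b i \<in> \<rat>"
    "\<exists>i<N. b i \<noteq> 0" "\<And>x. x \<in> X \<Longrightarrow> (\<Sum>i<N. b i * peval (p i) x) = 0" by blast
  from common_denominator[of N b, OF b(1)] obtain D :: int
    where D: "D \<noteq> 0" "\<And>i. i < N \<Longrightarrow> of_int D * b i \<in> \<int>" by blast
  have "\<forall>i\<in>{..<N}. \<exists>e :: int. of_int D * b i = of_int e"
    using D(2) by (auto elim: Ints_cases)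
  from bchoice[OF this] obtain e :: "nat \<Rightarrow> int" where e: "\<And>i. i < N \<Longrightarrow> of_int D * b i = of_int (e i)"
    by auto
  have "\<phi> i \<in> coord_ring r V" if "i < N" for i
    using M basis that by (auto simp: is_int_basis_def)
  then have "\<forall>i\<in>{..<N}. \<exists>q. q \<in> polys_over \<rat> r \<and> \<phi> i = restrict (peval q) V"
    unfolding coord_ring_def by blast
  from bchoice[OF this] obtain q where q: "\<And>i. i < N \<Longrightarrow> q i \<in> polys_over \<rat> r"
    "\<And>i. i < N \<Longrightarrow> \<phi> i = restrict (peval (q i)) V" by auto
  \<comment> \<open>Independence of the basis is a statement on \<open>V\<close>, but the relation
    holds on the image of \<open>X\<close>. Written as one rational polynomial, it passes to the
    rational Zariski closure.\<close>
  have "poly_fun \<rat> r (\<lambda>y. \<Sum>i<N. of_int (e i) * peval (q i) y)"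
    by (intro poly_fun_sum poly_fun_mult poly_fun_const complex_subring_Rats poly_fun_peval q(1) Rats_of_int) simp
  then obtain P where P: "P \<in> polys_over \<rat> r" "\<And>y. (\<Sum>i<N. of_int (e i) * peval (q i) y) = peval P y"
    by (auto simp: poly_fun_def fun_eq_iff)
  have on_V: "(\<Sum>i<N. of_int (e i) * \<phi> i y) = peval P y" if "y \<in> V" for y
    using that q(2) by (simp flip: P(2))
  have "peval P y = 0" if y: "y \<in> morphism_map r f ` X" for y
  proof -
    from y obtain x where x: "x \<in> X" "y = morphism_map r f x" by blast
    have "y \<in> V" unfolding V x(2) using x(1) by (rule morphism_map_in_closure)
    then have "peval P y = (\<Sum>i<N. of_int (e i) * \<phi> i y)" by (simp add: on_V)
    also have "\<dots> = (\<Sum>i<N. of_int D * (b i * peval (p i) x))"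
      using p(2)[OF _ x(1)] x(2) by (intro sum.cong) (auto simp flip: e)
    also have "\<dots> = 0" using b(3)[OF x(1)] by (simp flip: sum_distrib_left)
    finally show ?thesis .
  qed
  then have "peval P y = 0" if "y \<in> V" for y
    using that P(1) unfolding V zariski_closure_def by blast
  then have "\<forall>i<N. e i = 0" using basis on_V by (simp add: is_int_basis_def)
  then show False using b(2) D(1) e by fastforce
qed

text \<open>The constant is a function of the mass, chosen before dimensions, variety and chain.
  Strictness is claimed for nonzero \<open>t\<close>, because for \<open>t = 0\<close> both roots
  are 0.\<close>

theorem corollary3p7:
  shows "\<exists>C :: real \<Rightarrow> nat. \<forall>n r d X Y f w \<sigma> V M N \<phi> g Q t.
    affine_variety n X \<longrightarrow>
    (\<forall>k<r. f k \<in> coord_ring n X) \<longrightarrow>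
    V = zariski_closure \<rat> r (morphism_map r f ` X) \<longrightarrow>
    w \<in> diff_forms n X d \<longrightarrow>
    divisor_of n X Y \<longrightarrow>
    relative_chain n d X Y \<sigma> \<longrightarrow>
    M \<subseteq> coord_ring r V \<longrightarrow>
    is_int_basis M V N \<phi> \<longrightarrow>
    g = (\<lambda>i x. \<phi> i (morphism_map r f x)) \<longrightarrow>
    Q = period_matrix n d \<sigma> w N g \<longrightarrow>
    t = det_sup N g (chain_support d \<sigma>) \<longrightarrow>
    C (chain_mass n d \<sigma> w) < N \<longrightarrow>
      root N (cmod (Determinant.det Q)) \<le> root N (t ^ 2) \<and>
      (t \<noteq> 0 \<longrightarrow> root N (cmod (Determinant.det Q)) < root N (t ^ 2)) \<and>
      (nonneg_on_chain n d \<sigma> w \<longrightarrow>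
       chain_support d \<sigma> \<subseteq> zariski_closure UNIV n (nonvanishing_locus n d \<sigma> w) \<longrightarrow>
       (\<forall>i<N. \<forall>x\<in>chain_support d \<sigma>. g i x \<in> \<real>) \<longrightarrow>
       X \<subseteq> zariski_closure UNIV n (chain_support d \<sigma>) \<longrightarrow>
         Determinant.det Q \<in> \<real> \<and> 0 < root N (Re (Determinant.det Q)))"
proof -
  from power_less_fact have "\<forall>m. \<exists>C :: nat. \<forall>N>C. (m :: real) ^ N < fact N" by blast
  from choice[OF this] obtain C :: "real \<Rightarrow> nat" where C: "\<And>m N. C m < N \<Longrightarrow> m ^ N < fact N" by blast
  show ?thesis
  proof (intro exI[of _ C] allI impI)
    fix n r d X Y f w \<sigma> V M N \<phi> g Q t
    assume variety: "affine_variety n X"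
      and f: "\<forall>k<r. f k \<in> coord_ring n X"
      and V: "V = zariski_closure \<rat> r (morphism_map r f ` X)"
      and w: "w \<in> diff_forms n X d"
      and \<sigma>: "relative_chain n d X Y \<sigma>"
      and M: "M \<subseteq> coord_ring r V" and basis: "is_int_basis M V N \<phi>"
      and g: "g = (\<lambda>i x. \<phi> i (morphism_map r f x))"
      and Q: "Q = period_matrix n d \<sigma> w N g"
      and t: "t = det_sup N g (chain_support d \<sigma>)"
      and N: "C (chain_mass n d \<sigma> w) < N"
    interpret integration_chain n d X Y \<sigma> w
      using affine_variety_subset[OF variety] w \<sigma> by unfold_locales
    have g_poly: "\<exists>p\<in>polys_over UNIV n. \<forall>x\<in>X. g i x = peval p x" if "i < N" for i
      using int_basis_pulled_back_poly[OF f V M basis that] polys_over_mono[of \<rat> UNIV n] unfolding g by blast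
    let ?m = "chain_mass n d \<sigma> w"
    have less: "?m ^ N < fact N" by (rule C[OF N])
    have le: "fact N * cmod (Determinant.det Q) \<le> ?m ^ N * t\<^sup>2"
      unfolding Q t by (rule fact_det_period_matrix_le[OF g_poly])
    have strict: "cmod (Determinant.det Q) < t\<^sup>2" if "t \<noteq> 0"
    proof -
      note le
      also have "?m ^ N * t\<^sup>2 < fact N * t\<^sup>2" using less that by simp
      finally show ?thesis by simp
    qed
    have weak: "cmod (Determinant.det Q) \<le> t\<^sup>2"
    proof -
      note le
      also have "?m ^ N * t\<^sup>2 \<le> fact N * t\<^sup>2" using less by (intro mult_right_mono) auto
      finally show ?thesis by simp
    qed
    have "Determinant.det Q \<in> \<real> \<and> 0 < root N (Re (Determinant.det Q))"
      if nonneg: "nonneg_on_chain n d \<sigma> w"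
        and locus: "chain_support d \<sigma> \<subseteq> zariski_closure UNIV n (nonvanishing_locus n d \<sigma> w)"
        and real: "\<forall>i<N. \<forall>x\<in>chain_support d \<sigma>. g i x \<in> \<real>"
        and dense: "X \<subseteq> zariski_closure UNIV n (chain_support d \<sigma>)"
    proof -
      have det: "Determinant.det Q \<in> \<real>\<^sub>\<ge>\<^sub>0"
        unfolding Q by (rule det_period_matrix_nonneg[OF g_poly _ nonneg]) (use real in auto)
      have "Determinant.det Q \<noteq> 0"
      proof
        assume "Determinant.det Q = 0"
        then have "\<exists>c. (\<exists>i<N. c i \<noteq> 0) \<and> (\<forall>x\<in>nonvanishing_locus n d \<sigma> w. (\<Sum>i<N. c i * g i x) = 0)"
          unfolding Q by (intro det_period_matrix_zero_relation[OF g_poly _ nonneg]) (use real in auto)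
        then obtain c i where c: "i < N" "c i \<noteq> 0"
          "\<And>x. x \<in> nonvanishing_locus n d \<sigma> w \<Longrightarrow> (\<Sum>i<N. c i * g i x) = 0" by blast
        have "\<forall>i\<in>{..<N}. \<exists>p. p \<in> polys_over UNIV n \<and> (\<forall>x\<in>X. g i x = peval p x)"
          using g_poly by blast
        from bchoice[OF this] obtain p where p: "\<And>i. i < N \<Longrightarrow> p i \<in> polys_over UNIV n"
          "\<And>i x. i < N \<Longrightarrow> x \<in> X \<Longrightarrow> g i x = peval (p i) x" by auto
        \<comment> \<open>As one polynomial, the relation spreads from the nonvanishing locus to the
          support and from there to \<open>X\<close>. Its coefficients are complex, hence the
          closures over \<open>UNIV\<close>.\<close>
        have "poly_fun UNIV n (\<lambda>x. \<Sum>i<N. c i * peval (p i) x)"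
          by (intro poly_fun_sum poly_fun_mult poly_fun_const complex_subring_UNIV poly_fun_peval p(1) UNIV_I) simp
        then obtain P where P: "P \<in> polys_over UNIV n" "\<And>x. (\<Sum>i<N. c i * peval (p i) x) = peval P x"
          by (auto simp: poly_fun_def fun_eq_iff)
        have on_X: "(\<Sum>i<N. c i * g i x) = peval P x" if "x \<in> X" for x
          using p(2)[OF _ that] by (simp flip: P(2))
        have "peval P x = 0" if "x \<in> nonvanishing_locus n d \<sigma> w" for x
          using c(3)[OF that] on_X locus_subset that by auto
        then have "peval P x = 0" if "x \<in> chain_support d \<sigma>" for x
          using locus that P(1) unfolding zariski_closure_def by blast
        then have "peval P x = 0" if "x \<in> X" for x
          using dense that P(1) unfolding zariski_closure_def by blast
        then have "(\<Sum>i<N. c i * \<phi> i (morphism_map r f x)) = 0" if "x \<in> X" for x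
          using on_X[OF that] that by (simp add: g)
        from int_basis_independent[OF variety f V M basis this c(1)] c(2) show False by blast
      qed
      then have "0 < Re (Determinant.det Q)"
        using det by (auto simp: complex_nonneg_Reals_iff complex_eq_iff)
      \<comment> \<open>\<open>N\<close> exceeds a natural number and so is positive;
        \<open>root 0\<close> would be constantly 0.\<close>
      then show ?thesis
        using det N by (auto simp: real_root_gt_zero elim: nonneg_Reals_cases)
    qed
    then show "root N (cmod (Determinant.det Q)) \<le> root N (t ^ 2) \<and>
      (t \<noteq> 0 \<longrightarrow> root N (cmod (Determinant.det Q)) < root N (t ^ 2)) \<and>
      (nonneg_on_chain n d \<sigma> w \<longrightarrow>
       chain_support d \<sigma> \<subseteq> zariski_closure UNIV n (nonvanishing_locus n d \<sigma> w) \<longrightarrow>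
       (\<forall>i<N. \<forall>x\<in>chain_support d \<sigma>. g i x \<in> \<real>) \<longrightarrow>
       X \<subseteq> zariski_closure UNIV n (chain_support d \<sigma>) \<longrightarrow>
         Determinant.det Q \<in> \<real> \<and> 0 < root N (Re (Determinant.det Q)))"
      using weak strict N by (auto intro: real_root_le_mono real_root_less_mono)
  qed
qed

end
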